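(* Let $\kappa\ge5$ and let $x\in[0,1]$ have symbolic path $s_1s_2s_3\cdots$ in the Farey binary tree of length at least $\kappa-2$ (i.e. $x$ irrational, or $x$ rational lying in level $\ell_n$ with $n\ge\kappa-1$). Then $P(\kappa,x)=0$ if and only if $s_{\kappa-3}=s_{\kappa-2}$ (i.e. the path has a repetition $LL$ or $RR$ at position $\kappa-2$).
   Context: Farey binary tree: level $\ell_1=\{0/1,1/1\}$, and $\ell_{n+1}$ consists of the mediants $\frac{p+p'}{q+q'}$ of all pairs $p/q<p'/q'$ adjacent (in increasing order) in $\bigcup_{i\le n}\ell_i$. Every reduced fraction in $[0,1]$ occurs once; each $p/q\in(0,1)$ is the mediant of a unique adjacent pair $p_1/q_1<p_2/q_2$ (its left/right parents). Symbolic path: starting at $1/1$, the step $1/1\to1/2$ is $L$; a node at level $n\ge2$ has two children at level $n+1$, $L$ leading to the smaller and $R$ to the larger, so a rational in $\ell_n$ has a path of length $n-1$. If $x=[a_1,a_2,\dots]$ (continued fraction $x=1/(a_1+1/(a_2+\cdots))$) the path is $L^{a_1}R^{a_2}L^{a_3}\cdots$ (for rational $x=[a_1,\dots,a_m]$, $a_m\ge2$, the last exponent is $a_m-1$); irrationals have infinite paths. Haros graphs: $G_0$ has two nodes joined by an edge. For $G$ with ordered nodes $v_1,\dots,v_a$ and $G'$ with $w_1,\dots,w_b$, $G\oplus G'$ has nodes $u_1,\dots,u_{a+b-1}$ obtained by identifying $v_a$ with $w_1$, keeping all edges, and adding an edge $u_1u_{a+b-1}$. $G_{0/1}=G_{1/1}=G_0$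 and $G_{p/q}=G_{p_1/q_1}\oplus G_{p_2/q_2}$ for the parents $p_1/q_1<p_2/q_2$ of $p/q$. Degree convention: first and last nodes are identified into one boundary node with degree the sum of their degrees, giving $q$ nodes; $P(k,p/q)$ is the fraction of them with degree $k$. For irrational $x$, $P(k,x)=\lim_j P(k,x_j)$ along the rationals $x_j$ visited by the path of $x$. *)

theory Defs
  imports Complex_Main "HOL-Library.Extended_Nat"
begin

section \<open>The Farey binary tree\<close>

text \<open>A fraction \<open>p/q\<close> is kept as the pair \<open>(p, q)\<close>, since mediants are formed from numerators and
  denominators.\<close>

type_synonym fraction = "nat \<times> nat"

definition frac_val :: "fraction \<Rightarrow> real" where
  "frac_val f = real (fst f) / real (snd f)"

definition mediant :: "fraction \<Rightarrow> fraction \<Rightarrow> fraction" where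
  "mediant f g = (fst f + fst g, snd f + snd g)"

definition adjacent_in :: "fraction set \<Rightarrow> fraction \<Rightarrow> fraction \<Rightarrow> bool" where
  "adjacent_in S f g \<longleftrightarrow> f \<in> S \<and> g \<in> S \<and> frac_val f < frac_val g \<and>
     \<not> (\<exists>h\<in>S. frac_val f < frac_val h \<and> frac_val h < frac_val g)"

text \<open>Levels are numbered from 1; level 0 is a dummy.\<close>

function farey_level :: "nat \<Rightarrow> fraction set" where
  "farey_level 0 = {}"
| "farey_level (Suc 0) = {(0, 1), (1, 1)}"
| "farey_level (Suc (Suc n)) =
     {mediant f g | f g. adjacent_in (\<Union>i\<in>{1..Suc n}. farey_level i) f g}"
  by pat_completeness auto
termination by (relation "measure id") auto

definition parents :: "fraction \<Rightarrow> fraction \<Rightarrow> fraction \<Rightarrow> bool" where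
  "parents f\<^sub>1 f\<^sub>2 f \<longleftrightarrow>
     (\<exists>n\<ge>1. adjacent_in (\<Union>i\<in>{1..n}. farey_level i) f\<^sub>1 f\<^sub>2) \<and> f = mediant f\<^sub>1 f\<^sub>2"

definition is_child :: "fraction \<Rightarrow> fraction \<Rightarrow> bool" where
  "is_child f g \<longleftrightarrow> (\<exists>n\<ge>2. f \<in> farey_level n \<and> g \<in> farey_level (n + 1)) \<and>
     (\<exists>h. parents f h g \<or> parents h f g)"

definition farey_fraction :: "real \<Rightarrow> fraction" where
  "farey_fraction x = (THE f. (\<exists>n. f \<in> farey_level n) \<and> frac_val f = x)"

section \<open>Symbolic paths\<close>

datatype step = L | R

inductive node_path :: "fraction \<Rightarrow> step list \<Rightarrow> bool" where
  root: "node_path (1, 1) []"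
| first: "node_path (1, 2) [L]"
| left: "node_path f w \<Longrightarrow> is_child f g \<Longrightarrow> is_child f g' \<Longrightarrow> frac_val g < frac_val g' \<Longrightarrow>
    node_path g (w @ [L])"
| right: "node_path f w \<Longrightarrow> is_child f g \<Longrightarrow> is_child f g' \<Longrightarrow> frac_val g < frac_val g' \<Longrightarrow>
    node_path g' (w @ [R])"

text \<open>The node \<open>0/1\<close> lies in level 1, so its path is empty, although it is not reached from \<open>1/1\<close>.\<close>

definition rational_path :: "real \<Rightarrow> step list" where
  "rational_path x = (if x = 0 then [] else (THE w. node_path (farey_fraction x) w))"

text \<open>\<open>x = [a\<^sub>1, a\<^sub>2, \<dots>]\<close> with \<open>a\<^sub>n = cf_quotient x n\<close> for \<open>n \<ge> 1\<close>.\<close>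

primrec cf_remainder :: "real \<Rightarrow> nat \<Rightarrow> real" where
  "cf_remainder x 0 = x"
| "cf_remainder x (Suc n) = frac (1 / cf_remainder x n)"

definition cf_quotient :: "real \<Rightarrow> nat \<Rightarrow> nat" where
  "cf_quotient x n = nat \<lfloor>1 / cf_remainder x (n - 1)\<rfloor>"

text \<open>The \<open>k\<close>-th letter (\<open>k \<ge> 1\<close>) of the infinite word \<open>L\<^bsup>a\<^sub>1\<^esup>R\<^bsup>a\<^sub>2\<^esup>L\<^bsup>a\<^sub>3\<^esup>\<dots>\<close>: it lies in the \<open>m\<close>-th block.\<close>

definition irrational_path :: "real \<Rightarrow> nat \<Rightarrow> step" where
  "irrational_path x k =
     (let m = (LEAST m. k \<le> (\<Sum>i=1..m. cf_quotient x i)) in if odd m then L else R)"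

text \<open>The letter \<open>s\<^sub>k\<close>, meaningful for \<open>1 \<le> k\<close> up to the length of the path.\<close>

definition path_step :: "real \<Rightarrow> nat \<Rightarrow> step" where
  "path_step x k = (if x \<in> \<rat> then rational_path x ! (k - 1) else irrational_path x k)"

definition path_length :: "real \<Rightarrow> enat" where
  "path_length x = (if x \<in> \<rat> then enat (length (rational_path x)) else \<infinity>)"

text \<open>The node reached after the first \<open>j\<close> steps of the path.\<close>

definition path_node :: "real \<Rightarrow> nat \<Rightarrow> fraction" where
  "path_node x j = (THE f. node_path f (map (path_step x) [1..<j + 1]))"

section \<open>Haros graphs\<close>

text \<open>The ordered nodes are \<open>1, \<dots>, order G\<close>; an edge is the set of its two ends.\<close>

record ordered_graph =
  order :: nat
  edges :: "nat set set"

definition initial_graph :: ordered_graph where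
  "initial_graph = \<lparr>order = 2, edges = {{1, 2}}\<rparr>"

definition graph_concat :: "ordered_graph \<Rightarrow> ordered_graph \<Rightarrow> ordered_graph" (infixl "\<oplus>" 65) where
  "G \<oplus> G' = \<lparr>order = order G + order G' - 1,
     edges = edges G \<union> (\<lambda>e. (\<lambda>i. i + order G - 1) ` e) ` edges G' \<union>
       {{1, order G + order G' - 1}}\<rparr>"

inductive is_haros_graph :: "fraction \<Rightarrow> ordered_graph \<Rightarrow> bool" where
  "is_haros_graph (0, 1) initial_graph"
| "is_haros_graph (1, 1) initial_graph"
| "parents f\<^sub>1 f\<^sub>2 f \<Longrightarrow> is_haros_graph f\<^sub>1 G\<^sub>1 \<Longrightarrow> is_haros_graph f\<^sub>2 G\<^sub>2 \<Longrightarrow>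
    is_haros_graph f (G\<^sub>1 \<oplus> G\<^sub>2)"

definition haros_graph :: "fraction \<Rightarrow> ordered_graph" where
  "haros_graph f = (THE G. is_haros_graph f G)"

definition degree :: "ordered_graph \<Rightarrow> nat \<Rightarrow> nat" where
  "degree G i = card {e \<in> edges G. i \<in> e}"

text \<open>After identifying the first and the last node, the nodes are \<open>1, \<dots>, order G - 1\<close>, where \<open>1\<close> is
  the boundary node.\<close>

definition merged_degree :: "ordered_graph \<Rightarrow> nat \<Rightarrow> nat" where
  "merged_degree G i = (if i = 1 then degree G 1 + degree G (order G) else degree G i)"

definition degree_fraction :: "nat \<Rightarrow> ordered_graph \<Rightarrow> real" where
  "degree_fraction k G =
     real (card {i \<in> {1..<order G}. merged_degree G i = k}) / real (card {1..<order G})"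

definition degree_dist :: "nat \<Rightarrow> real \<Rightarrow> real" where
  "degree_dist k x =
     (if x \<in> \<rat> then degree_fraction k (haros_graph (farey_fraction x))
      else lim (\<lambda>j. degree_fraction k (haros_graph (path_node x j))))"

end

theory Submission imports Defs begin

text \<open>A nonempty path is a word \<open>L # u\<close>; the word \<open>u\<close> selects a Farey interval whose mediant is the node
  reached. The interior nodes of a Haros graph are the junctions created at the ancestors of its
  fraction. A node in level \<open>n \<ge> 2\<close> has boundary degree \<open>n + 2\<close>, and the junction created by a step
  towards an endpoint of the current interval has degree one more than the boundary degree of that
  endpoint. A degree \<open>\<kappa>\<close> therefore arises exactly when the path node in level \<open>\<kappa> - 3\<close> is an endpoint
  towards which the path steps; this node leaves the interval at once if
  \<open>s\<^bsub>\<kappa>-3\<^esub> = s\<^bsub>\<kappa>-2\<^esub>\<close>, and otherwise creates a junction of degree \<open>\<kappa>\<close> that all later graphs contain.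

  For irrational \<open>x\<close> the path turns infinitely often, so from some point on the number of nodes of
  degree \<open>\<kappa>\<close> is additive under mediants, i.e. a linear form \<open>A p + B q\<close>. The limit \<open>A x + B\<close> is a
  positive combination of its values at the two endpoints of an interval containing \<open>x\<close>, hence
  positive if one of them is.\<close>

section \<open>Farey intervals indexed by words\<close>

text \<open>The combining operation is a parameter so that one walk serves both the fractions, with
  \<open>mediant\<close>, and the graphs, with \<open>\<oplus>\<close>; the start pair is free so
  that 1/0 can replace 1/1 as the right end.\<close>

fun descend :: "('a \<Rightarrow> 'a \<Rightarrow> 'a) \<Rightarrow> 'a \<times> 'a \<Rightarrow> step list \<Rightarrow> 'a \<times> 'a" where
  "descend c (a, b) [] = (a, b)"
| "descend c (a, b) (L # w) = descend c (a, c a b) w"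
| "descend c (a, b) (R # w) = descend c (c a b, b) w"

text \<open>The recursion reads a word from the front and changes the start pair, whereas a path
  grows at its end.\<close>

lemma descend_snoc:
  "descend c I (w @ [s]) = (let (a, b) = descend c I w in
     case s of L \<Rightarrow> (a, c a b) | R \<Rightarrow> (c a b, b))"
  by (induction c I w rule: descend.induct) (cases s; simp)+

definition lo :: "step list \<Rightarrow> fraction" where
  "lo u = fst (descend mediant ((0, 1), (1, 1)) u)"

definition hi :: "step list \<Rightarrow> fraction" where
  "hi u = snd (descend mediant ((0, 1), (1, 1)) u)"

definition mid :: "step list \<Rightarrow> fraction" where
  "mid u = mediant (lo u) (hi u)"

lemma lo_hi_simps [simp]:
  "lo [] = (0, 1)" "hi [] = (1, 1)"
  "lo (u @ [L]) = lo u" "hi (u @ [L]) = mid u"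
  "lo (u @ [R]) = mid u" "hi (u @ [R]) = hi u"
  by (simp_all add: lo_def hi_def mid_def descend_snoc Let_def split: prod.splits)

lemma fst_mid: "fst (mid u) = fst (lo u) + fst (hi u)"
  and snd_mid: "snd (mid u) = snd (lo u) + snd (hi u)"
  by (simp_all add: mid_def mediant_def)

text \<open>Replacing either end by the sum of both is a column operation, which preserves the
  determinant.\<close>

lemma lo_hi_determinant: "fst (hi u) * snd (lo u) = fst (lo u) * snd (hi u) + 1"
proof (induction u rule: rev_induct)
  case (snoc s u)
  then show ?case by (cases s) (simp_all add: fst_mid snd_mid algebra_simps)
qed simp

lemma snd_lo_pos: "0 < snd (lo u)" and snd_hi_pos: "0 < snd (hi u)"
proof (induction u rule: rev_induct)
  case (snoc s u)
  case 1 with snoc show ?case by (cases s) (simp_all add: snd_mid)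
  case 2 with snoc show ?case by (cases s) (simp_all add: snd_mid)
qed simp_all

lemma snd_mid_pos: "0 < snd (mid u)"
  using snd_lo_pos by (simp add: snd_mid)

text \<open>Each step adds one of the two positive denominators to the sum.\<close>

lemma snd_lo_add_snd_hi_ge: "length u + 2 \<le> snd (lo u) + snd (hi u)"
proof (induction u rule: rev_induct)
  case (snoc s u)
  then show ?case using snd_lo_pos[of u] snd_hi_pos[of u] by (cases s) (simp_all add: snd_mid)
qed simp

section \<open>Reducedness of the mediants\<close>

lemma coprime_mid: "coprime (fst (mid u)) (snd (mid u))"
proof (rule coprimeI)
  fix c assume c: "c dvd fst (mid u)" "c dvd snd (mid u)"
  \<comment> \<open>The pair \<open>lo u\<close>, \<open>mid u\<close> again has determinant one, so
    a common divisor divides 1.\<close>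
  have "fst (mid u) * snd (lo u) = fst (lo u) * snd (mid u) + 1"
    using lo_hi_determinant[of u] by (simp add: fst_mid snd_mid algebra_simps)
  with c show "is_unit c"
    by (metis dvd_add_right_iff dvd_mult dvd_mult2)
qed

definition reduced :: "fraction \<Rightarrow> bool" where
  "reduced f \<longleftrightarrow> coprime (fst f) (snd f) \<and> 0 < snd f"

lemma reduced_mid: "reduced (mid u)"
  by (simp add: reduced_def coprime_mid snd_mid_pos)

lemma reduced_eqI:
  assumes "reduced f" "reduced g" "frac_val f = frac_val g"
  shows "f = g"
proof -
  have "real (fst f * snd g) = real (fst g * snd f)"
    using assms by (simp add: frac_val_def reduced_def field_simps)
  hence "fst f * snd g = fst g * snd f"
    by (simp only: of_nat_eq_iff)
  thus ?thesis
    using assms coprime_crossproduct_nat[of "fst f" "snd f" "fst g" "snd g"]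
    by (auto simp: reduced_def prod_eq_iff mult.commute)
qed

section \<open>Order of mediants and injectivity of the coding by words\<close>

lemma frac_val_mediant:
  assumes "0 < snd f" "0 < snd g" "frac_val f < frac_val g"
  shows "frac_val f < frac_val (mediant f g)" "frac_val (mediant f g) < frac_val g"
  using assms by (auto simp: frac_val_def mediant_def divide_simps) (auto simp: algebra_simps)

definition ordered_pair :: "fraction \<times> fraction \<Rightarrow> bool" where
  "ordered_pair I \<longleftrightarrow> 0 < snd (fst I) \<and> 0 < snd (snd I) \<and> frac_val (fst I) < frac_val (snd I)"

lemma ordered_pair_mediant:
  assumes "ordered_pair (a, b)"
  shows "ordered_pair (a, mediant a b)" "ordered_pair (mediant a b, b)"
    "frac_val a < frac_val (mediant a b)" "frac_val (mediant a b) < frac_val b"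
  using assms frac_val_mediant[of a b] by (auto simp: ordered_pair_def mediant_def)

lemma descend_mediant_bounds:
  assumes "ordered_pair (a, b)" "descend mediant (a, b) w = (c, d)"
  shows "ordered_pair (c, d)" "frac_val a \<le> frac_val c" "frac_val d \<le> frac_val b"
proof -
  have "ordered_pair (c, d) \<and> frac_val a \<le> frac_val c \<and> frac_val d \<le> frac_val b"
    using assms
  proof (induction w arbitrary: a b)
    case (Cons s w)
    then show ?case
      using ordered_pair_mediant[OF Cons.prems(1)] by (cases s) fastforce+
  qed simp
  then show "ordered_pair (c, d)" "frac_val a \<le> frac_val c" "frac_val d \<le> frac_val b"
    by auto
qed

lemma descend_mediant_strict:
  assumes "ordered_pair (a, b)"
  shows "frac_val a < frac_val (case_prod mediant (descend mediant (a, b) w))"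
    "frac_val (case_prod mediant (descend mediant (a, b) w)) < frac_val b"
  using descend_mediant_bounds[OF assms, of w] ordered_pair_mediant(3,4)
  by (fastforce split: prod.split)+

text \<open>Binary search: the mediant of the start pair is the node of the empty word and strictly
  separates the nodes below \<open>L\<close> from those below \<open>R\<close>. Equal values thus
  force equal first letters, and the induction goes on in the subinterval.\<close>

lemma descend_mediant_inject:
  assumes "ordered_pair (a, b)"
    "frac_val (case_prod mediant (descend mediant (a, b) u)) =
     frac_val (case_prod mediant (descend mediant (a, b) v))"
  shows "u = v"
  using assms
proof (induction u arbitrary: a b v)
  case Nil
  note m = ordered_pair_mediant[OF Nil.prems(1)]
  show ?case
  proof (cases v)
    case (Cons s v')
    then show ?thesis
      using Nil.prems m(3,4) descend_mediant_strict[OF m(1), of v'] descend_mediant_strict[OF m(2), of v']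
      by (cases s) auto
  qed simp
next
  case (Cons s u)
  note m = ordered_pair_mediant[OF Cons.prems(1)]
  note st = descend_mediant_strict[OF m(1)] descend_mediant_strict[OF m(2)]
  show ?case
  proof (cases v)
    case Nil
    then show ?thesis
      using Cons.prems st(2)[of u] st(3)[of u] by (cases s) auto
  next
    case (Cons s' v')
    then show ?thesis
      using Cons.prems st(2)[of u] st(3)[of u] st(2)[of v'] st(3)[of v'] Cons.IH[OF m(1)] Cons.IH[OF m(2)]
      by (cases s; cases s') fastforce+
  qed
qed

lemma mid_eq_descend: "mid u = case_prod mediant (descend mediant ((0, 1), (1, 1)) u)"
  by (simp add: mid_def lo_def hi_def split_def)

lemma ordered_pair_unit: "ordered_pair ((0, 1), (1, 1))"
  by (simp add: ordered_pair_def frac_val_def)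

lemma frac_val_mid_inject: "frac_val (mid u) = frac_val (mid v) \<longleftrightarrow> u = v"
  using descend_mediant_inject[OF ordered_pair_unit] by (auto simp: mid_eq_descend)

lemma mid_inject [simp]: "mid u = mid v \<longleftrightarrow> u = v"
  using frac_val_mid_inject by metis

lemma frac_val_mid_bounds: "0 < frac_val (mid u)" "frac_val (mid u) < 1"
  using descend_mediant_strict[OF ordered_pair_unit, of u]
  by (simp_all add: mid_eq_descend frac_val_def)

lemma mid_not_end [simp]: "mid u \<noteq> (0, 1)" "mid u \<noteq> (Suc 0, Suc 0)"
  using frac_val_mid_bounds[of u] by (auto simp: frac_val_def)

lemma frac_val_lo_less_hi: "frac_val (lo u) < frac_val (hi u)"
  using descend_mediant_bounds(1)[OF ordered_pair_unit, of u]
  by (auto simp: ordered_pair_def lo_def hi_def)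

lemma frac_val_lo_mid_hi: "frac_val (lo u) < frac_val (mid u)" "frac_val (mid u) < frac_val (hi u)"
  using frac_val_mediant[OF snd_lo_pos snd_hi_pos frac_val_lo_less_hi] by (simp_all add: mid_def)

text \<open>The two children are separated by \<open>mid u\<close>, which is the upper end of one
  interval and the lower end of the other.\<close>

lemma mid_child_less_iff: "frac_val (mid (u @ [s])) < frac_val (mid (u @ [s'])) \<longleftrightarrow> s = L \<and> s' = R"
  using frac_val_lo_mid_hi[of "u @ [L]"] frac_val_lo_mid_hi[of "u @ [R]"] by (cases s; cases s') auto

section \<open>Levels, parents and paths\<close>

text \<open>Every gap of \<open>S\<close> receives exactly one new point, strictly inside it, so the
  gaps of \<open>T\<close> are the two halves of the gaps of \<open>S\<close>.\<close>

lemma adjacent_in_refinement: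
  assumes inj: "inj_on frac_val S" and pos: "\<And>f. f \<in> S \<Longrightarrow> 0 < snd f"
    and T: "T = S \<union> {mediant f g | f g. adjacent_in S f g}"
  shows "adjacent_in T a b \<longleftrightarrow>
    (\<exists>f g. adjacent_in S f g \<and> (a = f \<and> b = mediant f g \<or> a = mediant f g \<and> b = g))"
    (is "?lhs \<longleftrightarrow> ?rhs")
proof -
  have med: "frac_val f < frac_val (mediant f g)" "frac_val (mediant f g) < frac_val g"
    "f \<in> S" "g \<in> S" "mediant f g \<in> T" if "adjacent_in S f g" for f g
  proof -
    show fg: "f \<in> S" "g \<in> S" using that by (simp_all add: adjacent_in_def)
    have "frac_val f < frac_val g" using that by (simp add: adjacent_in_def)
    then show "frac_val f < frac_val (mediant f g)" "frac_val (mediant f g) < frac_val g"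
      using frac_val_mediant pos fg by blast+
    show "mediant f g \<in> T" using that unfolding T by blast
  qed
  have sep: "h \<in> S \<Longrightarrow> frac_val h \<le> frac_val f \<or> frac_val g \<le> frac_val h" if "adjacent_in S f g" for f g h
    using that unfolding adjacent_in_def by (meson not_less)
  have eq: "f = g" if "f \<in> S" "g \<in> S" "frac_val f = frac_val g" for f g
    using inj that by (auto dest: inj_onD)
  \<comment> \<open>Overlapping gaps coincide: no end of one lies strictly inside the other, which
    forces equal values of the ends.\<close>
  have same: "f = f' \<and> g = g'" if "adjacent_in S f g" "adjacent_in S f' g'"
    "frac_val f < frac_val g'" "frac_val f' < frac_val g" for f g f' g'
  proof -
    have "frac_val f < frac_val g" "frac_val f' < frac_val g'"
      using that by (simp_all add: adjacent_in_def)
    then have "frac_val f = frac_val f'" "frac_val g = frac_val g'"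
      using sep[OF that(1) med(3)[OF that(2)]] sep[OF that(1) med(4)[OF that(2)]]
        sep[OF that(2) med(3)[OF that(1)]] sep[OF that(2) med(4)[OF that(1)]] that(3,4)
      by linarith+
    then show ?thesis using eq med(3,4) that(1,2) by metis
  qed
  \<comment> \<open>The mediant is the only point of \<open>T\<close> inside its gap, since a new
    point from elsewhere would make two gaps overlap.\<close>
  have sepT: "h = mediant f g \<or> frac_val h \<le> frac_val f \<or> frac_val g \<le> frac_val h"
    if adj: "adjacent_in S f g" and h: "h \<in> T" for f g h
  proof (cases "h \<in> S")
    case False
    then obtain f' g' where h': "adjacent_in S f' g'" "h = mediant f' g'" using T h by blast
    show ?thesis
    proof (cases "frac_val f < frac_val g' \<and> frac_val f' < frac_val g")
      case True
      then show ?thesis using same[OF adj h'(1)] h'(2) by simp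
    next
      case False
      then show ?thesis using med(1,2)[OF h'(1)] h'(2) by auto
    qed
  qed (use sep adj in blast)
  show ?thesis
  proof
    assume ?lhs
    hence ab: "a \<in> T" "b \<in> T" "frac_val a < frac_val b"
      and none: "\<And>h. h \<in> T \<Longrightarrow> frac_val h \<le> frac_val a \<or> frac_val b \<le> frac_val h"
      unfolding adjacent_in_def by (auto simp: not_less)
    consider "a \<in> S" "b \<in> S" | f g where "adjacent_in S f g" "a = mediant f g"
      | f g where "a \<in> S" "adjacent_in S f g" "b = mediant f g"
      using ab T by blast
    then show ?rhs
    proof cases
      case 1
      have "adjacent_in S a b"
        using 1 ab none T unfolding adjacent_in_def by (meson UnI1 not_less)
      then show ?thesis using med(1,2)[of a b] none[OF med(5)[of a b]] by auto
    next
      case (2 f g)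
      have "g \<in> T" using med[OF 2(1)] T by blast
      have bg: "frac_val b = frac_val g"
        using none[OF \<open>g \<in> T\<close>] sepT[OF 2(1) ab(2)] med(1,2)[OF 2(1)] 2(2) ab(3) by auto
      \<comment> \<open>\<open>b\<close> has the value of the old point \<open>g\<close>, and a new
        point lies strictly inside a gap, where no old value occurs.\<close>
      have "b \<in> S"
      proof (rule ccontr)
        assume "b \<notin> S"
        then obtain f' g' where "adjacent_in S f' g'" "b = mediant f' g'" using T ab(2) by blast
        then show False
          using sep[of f' g' g] med(1,2)[of f' g'] med(4)[OF 2(1)] bg by auto
      qed
      then show ?thesis using eq[OF _ _ bg] med(4)[OF 2(1)] 2 by blast
    next
      case (3 f g)
      have "f \<in> T" using med[OF 3(2)] T by blast
      have "frac_val a = frac_val f"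
        using none[OF \<open>f \<in> T\<close>] sepT[OF 3(2) ab(1)] med(1,2)[OF 3(2)] 3(3) ab(3) by auto
      then show ?thesis using eq[of a f] 3 med(3)[OF 3(2)] by blast
    qed
  next
    assume ?rhs
    then obtain f g where fg: "adjacent_in S f g"
      "a = f \<and> b = mediant f g \<or> a = mediant f g \<and> b = g" by blast
    have "f \<in> T" "g \<in> T" using med(3,4)[OF fg(1)] T by auto
    moreover have "\<not> (frac_val a < frac_val h \<and> frac_val h < frac_val b)" if "h \<in> T" for h
      using sepT[OF fg(1) that] med(1,2)[OF fg(1)] fg(2) by auto
    ultimately show ?lhs
      using fg(2) med(1,2,5)[OF fg(1)] unfolding adjacent_in_def by blast
  qed
qed

section \<open>Levels and adjacent pairs in terms of words\<close>

definition farey_upto :: "nat \<Rightarrow> fraction set" where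
  "farey_upto n = (\<Union>i\<in>{1..n}. farey_level i)"

lemma farey_level_Suc_Suc:
  "farey_level (Suc (Suc n)) = {mediant f g | f g. adjacent_in (farey_upto (Suc n)) f g}"
  by (simp add: farey_upto_def)

declare farey_level.simps(3) [simp del]

lemma farey_upto_one: "farey_upto (Suc 0) = {(0, 1), (1, 1)}"
  by (simp add: farey_upto_def)

lemma farey_upto_Suc_Suc:
  "farey_upto (Suc (Suc n)) =
     farey_upto (Suc n) \<union> {mediant f g | f g. adjacent_in (farey_upto (Suc n)) f g}"
proof -
  have "{1..Suc (Suc n)} = insert (Suc (Suc n)) {1..Suc n}" by auto
  then show ?thesis
    unfolding farey_level_Suc_Suc[symmetric] by (auto simp: farey_upto_def)
qed

text \<open>Both claims need a joint induction: reducedness makes \<open>frac_val\<close> injective,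
  as the refinement of gaps requires, and the description of the gaps identifies the new points as
  mediants \<open>mid u\<close>, which are reduced.\<close>

lemma farey_upto_structure:
  "(\<forall>f\<in>farey_upto (Suc n). reduced f) \<and>
   (\<forall>f g. adjacent_in (farey_upto (Suc n)) f g \<longleftrightarrow> (\<exists>u. length u = n \<and> f = lo u \<and> g = hi u))"
proof (induction n)
  case 0
  show ?case
    by (auto simp: farey_upto_one reduced_def adjacent_in_def frac_val_def)
next
  case (Suc n)
  hence red: "\<And>f. f \<in> farey_upto (Suc n) \<Longrightarrow> reduced f"
    and adj: "\<And>f g. adjacent_in (farey_upto (Suc n)) f g \<longleftrightarrow> (\<exists>u. length u = n \<and> f = lo u \<and> g = hi u)"
    by blast+
  have inj: "inj_on frac_val (farey_upto (Suc n))"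
    by (rule inj_onI) (intro reduced_eqI red)
  have pos: "0 < snd f" if "f \<in> farey_upto (Suc n)" for f
    using red[OF that] by (simp add: reduced_def)
  note refine = adjacent_in_refinement[OF inj pos farey_upto_Suc_Suc]
  have "adjacent_in (farey_upto (Suc (Suc n))) f g \<longleftrightarrow> (\<exists>u. length u = Suc n \<and> f = lo u \<and> g = hi u)"
    (is "?l \<longleftrightarrow> ?r") for f g
  proof -
    have "?l \<longleftrightarrow> (\<exists>u. length u = n \<and> (f = lo u \<and> g = mid u \<or> f = mid u \<and> g = hi u))"
      by (subst refine, assumption) (unfold adj mid_def, blast)
    also have "\<dots> \<longleftrightarrow> ?r"
    proof
      assume "\<exists>u. length u = n \<and> (f = lo u \<and> g = mid u \<or> f = mid u \<and> g = hi u)"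
      then obtain u where u: "length u = n" "f = lo u \<and> g = mid u \<or> f = mid u \<and> g = hi u" by blast
      have "f = lo (u @ [L]) \<and> g = hi (u @ [L]) \<or> f = lo (u @ [R]) \<and> g = hi (u @ [R])"
        using u(2) by simp
      with u(1) show ?r by (metis length_append_singleton)
    next
      assume ?r
      then obtain u where u: "length u = Suc n" "f = lo u" "g = hi u" by blast
      then obtain v s where "u = v @ [s]" by (metis length_Suc_conv_rev)
      with u show "\<exists>u. length u = n \<and> (f = lo u \<and> g = mid u \<or> f = mid u \<and> g = hi u)"
        by (cases s) auto
    qed
    finally show ?thesis .
  qed
  moreover have "reduced f" if "f \<in> farey_upto (Suc (Suc n))" for f
  proof -
    have "f \<in> farey_upto (Suc n) \<or> (\<exists>u. f = mid u)"
      using that unfolding farey_upto_Suc_Suc adj mid_def by blast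
    then show ?thesis using red reduced_mid by blast
  qed
  ultimately show ?case by blast
qed

lemma adjacent_in_farey_upto:
  "adjacent_in (farey_upto (Suc n)) f g \<longleftrightarrow> (\<exists>u. length u = n \<and> f = lo u \<and> g = hi u)"
  using farey_upto_structure by blast

lemma farey_level_eq_mid: "farey_level (Suc (Suc n)) = {mid u | u. length u = n}"
  unfolding farey_level_Suc_Suc adjacent_in_farey_upto mid_def by blast

text \<open>The empty word stands for 1/2 in level 2, hence the offset; the level is unique because
  \<open>mid\<close> is injective.\<close>

lemma mid_in_farey_level_iff: "mid u \<in> farey_level n \<longleftrightarrow> n = length u + 2"
proof (cases n rule: farey_level.cases)
  case 2
  then show ?thesis using mid_not_end[of u] by auto
next
  case (3 m)
  then show ?thesis by (auto simp: farey_level_eq_mid)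
qed simp

lemma in_some_farey_level_iff:
  "(\<exists>n. f \<in> farey_level n) \<longleftrightarrow> f = (0, 1) \<or> f = (1, 1) \<or> (\<exists>u. f = mid u)"
proof
  assume "\<exists>n. f \<in> farey_level n"
  then obtain n where "f \<in> farey_level n" ..
  then show "f = (0, 1) \<or> f = (1, 1) \<or> (\<exists>u. f = mid u)"
    by (cases n rule: farey_level.cases) (auto simp: farey_level_eq_mid)
next
  assume "f = (0, 1) \<or> f = (1, 1) \<or> (\<exists>u. f = mid u)"
  then show "\<exists>n. f \<in> farey_level n"
    by (metis farey_level.simps(2) insertCI mid_in_farey_level_iff)
qed

lemma parents_iff: "parents f g h \<longleftrightarrow> (\<exists>u. f = lo u \<and> g = hi u \<and> h = mid u)"
proof -
  have "(\<exists>n\<ge>1. adjacent_in (farey_upto n) f g) \<longleftrightarrow> (\<exists>n. adjacent_in (farey_upto (Suc n)) f g)"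
    by (metis One_nat_def Suc_le_D le_add1 plus_1_eq_Suc)
  hence "parents f g h \<longleftrightarrow> (\<exists>n. adjacent_in (farey_upto (Suc n)) f g) \<and> h = mediant f g"
    unfolding parents_def farey_upto_def[symmetric] by simp
  then show ?thesis
    unfolding adjacent_in_farey_upto by (auto simp: mid_def)
qed

text \<open>The ends of the interval of \<open>w\<close> occur up to level
  \<open>length w + 1\<close>, while \<open>mid u\<close> occurs in level
  \<open>length u + 2\<close> only.\<close>

lemma lo_hi_not_mid:
  assumes "length w \<le> length u"
  shows "lo w \<noteq> mid u" "hi w \<noteq> mid u"
proof -
  have "adjacent_in (farey_upto (Suc (length w))) (lo w) (hi w)"
    by (auto simp: adjacent_in_farey_upto)
  hence "lo w \<in> farey_upto (Suc (length w))" "hi w \<in> farey_upto (Suc (length w))"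
    by (simp_all add: adjacent_in_def)
  moreover have "mid u \<notin> farey_upto (Suc (length w))"
    using assms by (auto simp: farey_upto_def mid_in_farey_level_iff)
  ultimately show "lo w \<noteq> mid u" "hi w \<noteq> mid u" by metis+
qed

lemma is_child_iff: "is_child f g \<longleftrightarrow> (\<exists>u s. f = mid u \<and> g = mid (u @ [s]))"
proof
  assume "is_child f g"
  then obtain n h where n: "2 \<le> n" "f \<in> farey_level n" "g \<in> farey_level (n + 1)"
    and "parents f h g \<or> parents h f g"
    unfolding is_child_def by blast
  then obtain v where v: "f = lo v \<or> f = hi v" "g = mid v" by (auto simp: parents_iff)
  obtain k where k: "n = Suc (Suc k)" using n(1) by (metis add_2_eq_Suc le_Suc_ex)
  then obtain u where u: "f = mid u" "length u = k"
    using n(2) by (auto simp: farey_level_eq_mid)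
  have "length v = Suc (length u)" using n(3) u(2) k v(2) by (simp add: mid_in_farey_level_iff)
  then obtain w s where w: "v = w @ [s]" "length w = length u" by (metis length_Suc_conv_rev)
  \<comment> \<open>One end of the interval of \<open>w @ [s]\<close> is \<open>mid w\<close>; the
    other is an end of the interval of \<open>w\<close> and is too old to be
    \<open>mid u\<close>.\<close>
  have "f = mid w"
    using v(1) w lo_hi_not_mid[of w u] u(1) by (cases s) auto
  with v w show "\<exists>u s. f = mid u \<and> g = mid (u @ [s])" by blast
next
  assume "\<exists>u s. f = mid u \<and> g = mid (u @ [s])"
  then obtain u s where us: "f = mid u" "g = mid (u @ [s])" by blast
  have "\<exists>h. parents f h g \<or> parents h f g"
  proof (cases s)
    case L
    then have "parents (lo u) f g" unfolding parents_iff us by (metis lo_hi_simps(3,4))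
    then show ?thesis by blast
  next
    case R
    then have "parents f (hi u) g" unfolding parents_iff us by (metis lo_hi_simps(5,6))
    then show ?thesis by blast
  qed
  moreover have "f \<in> farey_level (length u + 2)" "g \<in> farey_level (length u + 2 + 1)"
    unfolding us mid_in_farey_level_iff by simp_all
  ultimately show "is_child f g" unfolding is_child_def by (metis le_add2)
qed

text \<open>The sibling in the rules \<open>left\<close> and \<open>right\<close> tells which child
  is the smaller one; by \<open>mid_child_less_iff\<close> this determines the appended
  letter.\<close>

lemma node_path_iff:
  "node_path f w \<longleftrightarrow> f = (1, 1) \<and> w = [] \<or> (\<exists>u. w = L # u \<and> f = mid u)"
proof
  assume "node_path f w"
  then show "f = (1, 1) \<and> w = [] \<or> (\<exists>u. w = L # u \<and> f = mid u)"
  proof induction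
    case first
    have "(1, 2) = mid []" by (simp add: mid_def mediant_def)
    then show ?case by blast
  next
    case (left f w g g')
    obtain u s s' where f: "f = mid u" "g = mid (u @ [s])" "g' = mid (u @ [s'])"
      using left.hyps(2,3) by (auto simp: is_child_iff)
    with left.IH left.hyps(4) show ?case by (auto simp: mid_child_less_iff)
  next
    case (right f w g g')
    obtain u s s' where f: "f = mid u" "g = mid (u @ [s])" "g' = mid (u @ [s'])"
      using right.hyps(2,3) by (auto simp: is_child_iff)
    with right.IH right.hyps(4) show ?case by (auto simp: mid_child_less_iff)
  qed simp
next
  have "node_path (mid u) (L # u)" for u
  proof (induction u rule: rev_induct)
    case Nil
    then show ?case using node_path.first by (simp add: mid_def mediant_def numeral_2_eq_2)
  next
    case (snoc s u)
    have "is_child (mid u) (mid (u @ [L]))" "is_child (mid u) (mid (u @ [R]))"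
      "frac_val (mid (u @ [L])) < frac_val (mid (u @ [R]))"
      unfolding is_child_iff mid_child_less_iff by blast+
    from node_path.left[OF snoc this] node_path.right[OF snoc this] show ?case
      by (cases s) auto
  qed
  then show "f = (1, 1) \<and> w = [] \<or> (\<exists>u. w = L # u \<and> f = mid u) \<Longrightarrow> node_path f w"
    using node_path.root by auto
qed

section \<open>Fractions and paths of the rational numbers\<close>

lemma farey_fraction_mid: "farey_fraction (frac_val (mid u)) = mid u"
  unfolding farey_fraction_def in_some_farey_level_iff
proof (intro the_equality conjI)
  fix f assume f: "(f = (0, 1) \<or> f = (1, 1) \<or> (\<exists>v. f = mid v)) \<and> frac_val f = frac_val (mid u)"
  have "frac_val (0, 1) = 0" "frac_val (1, 1) = 1" by (simp_all add: frac_val_def)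
  then show "f = mid u"
    using f frac_val_mid_bounds[of u] frac_val_mid_inject by (metis less_irrefl)
qed auto

lemma farey_fraction_one: "farey_fraction 1 = (1, 1)"
  unfolding farey_fraction_def in_some_farey_level_iff
proof (intro the_equality conjI)
  fix f assume f: "(f = (0, 1) \<or> f = (1, 1) \<or> (\<exists>u. f = mid u)) \<and> frac_val f = 1"
  have "f \<noteq> mid u" for u using f frac_val_mid_bounds(2)[of u] by auto
  moreover have "frac_val (0, 1) = 0" by (simp add: frac_val_def)
  hence "f \<noteq> (0, 1)" using f by auto
  ultimately show "f = (1, 1)" using f by blast
qed (auto simp: frac_val_def)

lemma rational_path_one: "rational_path 1 = []"
proof -
  have "(THE w. node_path (1, 1) w) = []"
    using mid_not_end(2) by (intro the_equality) (auto simp: node_path_iff dest: sym)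
  then show ?thesis by (simp add: rational_path_def farey_fraction_one)
qed

lemma rational_path_mid: "rational_path (frac_val (mid u)) = L # u"
proof -
  have "(THE w. node_path (mid u) w) = L # u"
    using mid_not_end(2) by (intro the_equality) (auto simp: node_path_iff)
  then show ?thesis
    using frac_val_mid_bounds(1)[of u] by (simp add: rational_path_def farey_fraction_mid)
qed

text \<open>Subtractive Euclidean algorithm on the weights: \<alpha> a + \<beta> b = (\<alpha> -
  \<beta>) a + \<beta> (a + b) if \<beta> < \<alpha>, and symmetrically. It stops when the weights
  agree, and \<open>k\<close> is their common value.\<close>

lemma descend_reaches_combination:
  assumes "0 < \<alpha>" "0 < \<beta>"
  shows "\<exists>w k. 0 < k \<and> (\<alpha> * fst a + \<beta> * fst b, \<alpha> * snd a + \<beta> * snd b) =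
    (let m = case_prod mediant (descend mediant (a, b) w) in (k * fst m, k * snd m))"
  using assms
proof (induction "\<alpha> + \<beta>" arbitrary: \<alpha> \<beta> a b rule: less_induct)
  case less
  consider "\<alpha> = \<beta>" | "\<beta> < \<alpha>" | "\<alpha> < \<beta>" by linarith
  then show ?case
  proof cases
    case 1
    then show ?thesis using less.prems
      by (intro exI[of _ "[]"] exI[of _ \<alpha>]) (simp add: mediant_def algebra_simps)
  next
    case 2
    then obtain \<delta> where d: "\<alpha> = \<beta> + \<delta>" "0 < \<delta>" by (metis less_imp_add_positive)
    from less.hyps[of \<delta> \<beta> a "mediant a b"] d less.prems obtain w k where
      "0 < k" "(\<delta> * fst a + \<beta> * fst (mediant a b), \<delta> * snd a + \<beta> * snd (mediant a b)) =
        (let m = case_prod mediant (descend mediant (a, mediant a b) w) in (k * fst m, k * snd m))"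
      by auto
    then show ?thesis using d
      by (intro exI[of _ "L # w"] exI[of _ k]) (simp add: mediant_def algebra_simps)
  next
    case 3
    then obtain \<delta> where d: "\<beta> = \<alpha> + \<delta>" "0 < \<delta>" by (metis less_imp_add_positive)
    from less.hyps[of \<alpha> \<delta> "mediant a b" b] d less.prems obtain w k where
      "0 < k" "(\<alpha> * fst (mediant a b) + \<delta> * fst b, \<alpha> * snd (mediant a b) + \<delta> * snd b) =
        (let m = case_prod mediant (descend mediant (mediant a b, b) w) in (k * fst m, k * snd m))"
      by auto
    then show ?thesis using d
      by (intro exI[of _ "R # w"] exI[of _ k]) (simp add: mediant_def algebra_simps)
  qed
qed

lemma rational_is_mid:
  assumes "x \<in> \<rat>" "0 < x" "x < 1"
  obtains u where "x = frac_val (mid u)"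
proof -
  obtain p q :: nat where pq: "q \<noteq> 0" "x = p / q"
    using Rats_abs_nat_div_natE[OF assms(1)] assms(2) by (metis abs_of_pos)
  have "0 < p" "p < q" using assms pq by (auto simp: field_simps)
  \<comment> \<open>The weights q - p and p on 0/1 and 1/1 produce numerator p and denominator q; a
    common factor of p and q goes into \<open>k\<close>.\<close>
  then obtain w k where k: "0 < k" "p = k * fst (mid w)" "q = k * snd (mid w)"
    using descend_reaches_combination[of "q - p" p "(0, 1)" "(1, 1)"] by (auto simp: mid_eq_descend Let_def)
  have "x = frac_val (mid w)" using k(1) by (simp add: pq(2) k(2,3) frac_val_def)
  then show ?thesis by (rule that)
qed

section \<open>Degrees in Haros graphs\<close>

definition glo :: "step list \<Rightarrow> ordered_graph" where
  "glo u = fst (descend (\<oplus>) (initial_graph, initial_graph) u)"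

definition ghi :: "step list \<Rightarrow> ordered_graph" where
  "ghi u = snd (descend (\<oplus>) (initial_graph, initial_graph) u)"

definition gmid :: "step list \<Rightarrow> ordered_graph" where
  "gmid u = glo u \<oplus> ghi u"

lemma glo_ghi_simps [simp]:
  "glo [] = initial_graph" "ghi [] = initial_graph"
  "glo (u @ [L]) = glo u" "ghi (u @ [L]) = gmid u"
  "glo (u @ [R]) = gmid u" "ghi (u @ [R]) = ghi u"
  by (simp_all add: glo_def ghi_def gmid_def descend_snoc Let_def split: prod.splits)

lemma is_haros_graph_lo_hi: "is_haros_graph (lo u) (glo u) \<and> is_haros_graph (hi u) (ghi u)"
proof (induction u rule: rev_induct)
  case Nil
  show ?case unfolding lo_hi_simps glo_ghi_simps by (intro conjI is_haros_graph.intros(1,2))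
next
  case (snoc s u)
  have "parents (lo u) (hi u) (mid u)" by (auto simp: parents_iff)
  with snoc have "is_haros_graph (mid u) (gmid u)"
    unfolding gmid_def by (blast intro: is_haros_graph.intros(3))
  with snoc show ?case by (cases s) auto
qed

lemma is_haros_graph_mid: "is_haros_graph (mid u) (gmid u)"
proof -
  have "parents (lo u) (hi u) (mid u)" by (auto simp: parents_iff)
  then show ?thesis
    using is_haros_graph_lo_hi[of u] unfolding gmid_def by (blast intro: is_haros_graph.intros(3))
qed

lemma parents_unique:
  assumes "parents f g h" "parents f' g' h"
  shows "f = f'" "g = g'"
  using assms by (auto simp: parents_iff)

lemma not_parents_end: "\<not> parents f g (0, 1)" "\<not> parents f g (1, 1)"
  using mid_not_end by (metis One_nat_def parents_iff)+

text \<open>A fraction has at most one pair of parents and neither end has any, so the last rule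
  applied is determined.\<close>

lemma is_haros_graph_unique: "is_haros_graph f G \<Longrightarrow> is_haros_graph f G' \<Longrightarrow> G = G'"
proof (induction arbitrary: G' rule: is_haros_graph.induct)
  case 1
  from 1 show ?case
    by (cases rule: is_haros_graph.cases) (use not_parents_end in auto)
next
  case 2
  from 2 show ?case
    by (cases rule: is_haros_graph.cases) (use not_parents_end in auto)
next
  case (3 f\<^sub>1 f\<^sub>2 f G\<^sub>1 G\<^sub>2)
  from 3(6) show ?case
  proof (cases rule: is_haros_graph.cases)
    case (3 f\<^sub>1' f\<^sub>2' G\<^sub>1' G\<^sub>2')
    with parents_unique[OF \<open>parents f\<^sub>1 f\<^sub>2 f\<close> \<open>parents f\<^sub>1' f\<^sub>2' f\<close>] \<open>\<And>G'. is_haros_graph f\<^sub>1 G' \<Longrightarrow> G\<^sub>1 = G'\<close>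
      \<open>\<And>G'. is_haros_graph f\<^sub>2 G' \<Longrightarrow> G\<^sub>2 = G'\<close>
    show ?thesis by metis
  qed (use 3(1) not_parents_end in auto)
qed

lemma haros_graph_mid: "haros_graph (mid u) = gmid u"
  unfolding haros_graph_def
  using is_haros_graph_mid is_haros_graph_unique by (intro the_equality) blast+

section \<open>Degrees under concatenation\<close>

definition wf_graph :: "ordered_graph \<Rightarrow> bool" where
  "wf_graph G \<longleftrightarrow> 2 \<le> order G \<and> (\<forall>e\<in>edges G. e \<subseteq> {1..order G} \<and> card e = 2)"

lemma order_concat: "order (G \<oplus> H) = order G + order H - 1"
  by (simp add: graph_concat_def)

lemma wf_initial_graph: "wf_graph initial_graph"
  by (auto simp: wf_graph_def initial_graph_def)

lemma wf_concat:
  assumes "wf_graph G" "wf_graph H"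
  shows "wf_graph (G \<oplus> H)"
proof -
  have inj: "inj_on (\<lambda>i. i + order G - 1) e" for e
    using assms by (auto simp: inj_on_def wf_graph_def)
  have shift: "(\<lambda>i. i + order G - 1) ` e \<subseteq> {1..order G + order H - 1}"
    "card ((\<lambda>i. i + order G - 1) ` e) = 2" if "e \<in> edges H" for e
  proof -
    have "\<forall>x\<in>e. 1 \<le> x \<and> x \<le> order H" "card e = 2"
      using that assms by (force simp: wf_graph_def)+
    then show "(\<lambda>i. i + order G - 1) ` e \<subseteq> {1..order G + order H - 1}"
      "card ((\<lambda>i. i + order G - 1) ` e) = 2"
      using assms(1) card_image[OF inj, of e] by (fastforce simp: wf_graph_def)+
  qed
  have "e \<subseteq> {1..order G + order H - 1} \<and> card e = 2" if e: "e \<in> edges (G \<oplus> H)" for e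
  proof -
    consider "e \<in> edges G" | e' where "e' \<in> edges H" "e = (\<lambda>i. i + order G - 1) ` e'"
      | "e = {1, order G + order H - 1}"
      using e unfolding graph_concat_def by auto
    then show ?thesis
    proof cases
      case 1
      then have "e \<subseteq> {1..order G}" "card e = 2" using assms by (auto simp: wf_graph_def)
      moreover have "{1..order G} \<subseteq> {1..order G + order H - 1}"
        using assms(2) by (auto simp: wf_graph_def)
      ultimately show ?thesis by blast
    next
      case 2
      then show ?thesis using shift by blast
    next
      case 3
      then show ?thesis using assms by (auto simp: wf_graph_def)
    qed
  qed
  then show ?thesis using assms by (auto simp: wf_graph_def order_concat)
qed

lemma finite_edges: "wf_graph G \<Longrightarrow> finite (edges G)"
  by (rule finite_subset[of _ "Pow {1..order G}"]) (auto simp: wf_graph_def)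

lemma degree_outside: "wf_graph G \<Longrightarrow> i \<notin> {1..order G} \<Longrightarrow> degree G i = 0"
  unfolding degree_def wf_graph_def by (subst card_eq_0_iff) blast

text \<open>The old edges of \<open>G\<close>, the shifted edges of \<open>H\<close> and the new
  edge are pairwise distinct, so the degrees add. Node \<open>i\<close> of the sum is node
  \<open>i - order G + 1\<close> of \<open>H\<close>.\<close>

lemma degree_concat:
  assumes G: "wf_graph G" and H: "wf_graph H"
  shows "degree (G \<oplus> H) i = degree G i + (if order G \<le> i then degree H (i - order G + 1) else 0)
    + (if i = 1 \<or> i = order G + order H - 1 then 1 else 0)"
proof -
  define a where "a = order G"
  define b where "b = order H"
  define sh where "sh = (\<lambda>i. i + a - 1)"
  have ab: "2 \<le> a" "2 \<le> b" using G H by (auto simp: wf_graph_def a_def b_def)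
  have EG: "\<And>e. e \<in> edges G \<Longrightarrow> e \<subseteq> {1..a} \<and> card e = 2" using G by (auto simp: wf_graph_def a_def)
  have EH: "\<And>e. e \<in> edges H \<Longrightarrow> e \<subseteq> {1..b} \<and> card e = 2" using H by (auto simp: wf_graph_def b_def)
  have inj: "inj sh" using ab by (auto simp: inj_def sh_def)
  have EH': "e \<subseteq> {a..a+b-1} \<and> card e = 2" if e: "e \<in> (`) sh ` edges H" for e
  proof -
    obtain e' where e': "e' \<in> edges H" "e = sh ` e'" using e by blast
    then show ?thesis
      using EH[OF e'(1)] ab card_image[OF inj_on_subset[OF inj subset_UNIV], of e'] by (fastforce simp: sh_def)
  qed
  let ?A = "{e \<in> edges G. i \<in> e}" and ?B = "{e \<in> (`) sh ` edges H. i \<in> e}"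
    and ?C = "{e \<in> {{1, a + b - 1}}. i \<in> e}"
  have fin: "finite ?A" "finite ?B" using finite_edges[OF G] finite_edges[OF H] by auto
  \<comment> \<open>The two summands share only the node \<open>a\<close>, and an edge has two
    ends.\<close>
  have AB: "?A \<inter> ?B = {}"
  proof (rule ccontr)
    assume "?A \<inter> ?B \<noteq> {}"
    then obtain e where "e \<in> edges G" "e \<in> (`) sh ` edges H" by blast
    then have "e \<subseteq> {1..a}" "card e = 2" "e \<subseteq> {a..a+b-1}" using EG EH' by auto
    moreover have "{1..a} \<inter> {a..a+b-1} \<subseteq> {a}" by auto
    ultimately have "e \<subseteq> {a}" by blast
    then show False using card_mono[of "{a}" e] \<open>card e = 2\<close> by simp
  qed
  have C: "(?A \<union> ?B) \<inter> ?C = {}"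
  proof (rule ccontr)
    assume "(?A \<union> ?B) \<inter> ?C \<noteq> {}"
    then have "{1, a + b - 1} \<in> edges G \<or> {1, a + b - 1} \<in> (`) sh ` edges H" by blast
    then have "{1, a + b - 1} \<subseteq> {1..a} \<or> {1, a + b - 1} \<subseteq> {a..a+b-1}"
      using EG[of "{1, a + b - 1}"] EH'[of "{1, a + b - 1}"] by fast
    then show False using ab by auto
  qed
  have "{e \<in> edges (G \<oplus> H). i \<in> e} = (?A \<union> ?B) \<union> ?C"
    unfolding graph_concat_def a_def[symmetric] b_def[symmetric] sh_def by auto
  then have "degree (G \<oplus> H) i = card ?A + card ?B + card ?C"
    unfolding degree_def using fin AB C by (simp add: card_Un_disjoint)
  moreover have "card ?C = (if i = 1 \<or> i = a + b - 1 then 1 else 0)"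
  proof -
    have "?C = (if i = 1 \<or> i = a + b - 1 then {{1, a + b - 1}} else {})" by auto
    then show ?thesis by simp
  qed
  moreover have "card ?B = (if a \<le> i then degree H (i - a + 1) else 0)"
  proof (cases "a \<le> i")
    case True
    then have i: "i = sh (i - a + 1)" using ab by (simp add: sh_def)
    have "i \<in> sh ` e \<longleftrightarrow> i - a + 1 \<in> e" for e
      by (metis i inj inj_image_mem_iff)
    then have "?B = (`) sh ` {e \<in> edges H. i - a + 1 \<in> e}" by blast
    moreover have "inj ((`) sh)" using inj by (simp add: inj_def inj_image_eq_iff)
    ultimately show ?thesis
      using True card_image[OF inj_on_subset[OF _ subset_UNIV], of "(`) sh"] by (simp add: degree_def)
  next
    case False
    have "i \<notin> e" if "e \<in> (`) sh ` edges H" for e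
      using EH'[OF that] False by auto
    then have "?B = {}" by blast
    then have "card ?B = 0" by (simp only: card.empty)
    with False show ?thesis by simp
  qed
  ultimately show ?thesis by (simp add: degree_def a_def b_def)
qed

definition first_degree :: "ordered_graph \<Rightarrow> nat" where
  "first_degree G = degree G 1"

definition last_degree :: "ordered_graph \<Rightarrow> nat" where
  "last_degree G = degree G (order G)"

definition boundary_degree :: "ordered_graph \<Rightarrow> nat" where
  "boundary_degree G = first_degree G + last_degree G"

definition junction_degree :: "ordered_graph \<Rightarrow> ordered_graph \<Rightarrow> nat" where
  "junction_degree G H = last_degree G + first_degree H"

text \<open>The outer nodes are counted separately: their degrees still grow under concatenation,
  while the degree of an interior node is final.\<close>

definition interior_count :: "nat \<Rightarrow> ordered_graph \<Rightarrow> nat" where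
  "interior_count k G = card {i \<in> {1<..<order G}. degree G i = k}"

lemma first_degree_concat:
  assumes "wf_graph G" "wf_graph H"
  shows "first_degree (G \<oplus> H) = first_degree G + 1"
  using assms by (simp add: first_degree_def degree_concat wf_graph_def)

lemma last_degree_concat:
  assumes "wf_graph G" "wf_graph H"
  shows "last_degree (G \<oplus> H) = last_degree H + 1"
proof -
  have ab: "2 \<le> order G" "2 \<le> order H" using assms by (auto simp: wf_graph_def)
  then have "degree G (order G + order H - 1) = 0"
    by (intro degree_outside assms) auto
  then show ?thesis
    using ab by (auto simp: last_degree_def degree_concat[OF assms] order_concat)
qed

text \<open>The added edge touches only the outer nodes, so the interior nodes of both summands keep
  their degrees and the shared node is the only new interior one.\<close>

lemma interior_count_concat:
  assumes "wf_graph G" "wf_graph H"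
  shows "interior_count k (G \<oplus> H) =
    interior_count k G + interior_count k H + of_bool (junction_degree G H = k)"
proof -
  define a where "a = order G"
  define b where "b = order H"
  define sh where "sh = (\<lambda>i. i + (a - 1))"
  have ab: "2 \<le> a" "2 \<le> b" using assms by (auto simp: wf_graph_def a_def b_def)
  let ?A = "{i \<in> {1<..<a}. degree G i = k}" and ?B = "{i \<in> {1<..<b}. degree H i = k}"
  let ?J = "{i \<in> {a}. junction_degree G H = k}"
  have deg: "degree (G \<oplus> H) i = (if i < a then degree G i else if i = a then junction_degree G H
      else degree H (i - (a - 1)))" if "1 < i" "i < a + b - 1" for i
  proof -
    have "degree G i = 0" if "a < i" using that assms(1) by (simp add: degree_outside a_def)
    then show ?thesis using that ab
      by (simp add: degree_concat[OF assms] junction_degree_def last_degree_def first_degree_def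
          Suc_diff_le flip: a_def b_def)
  qed
  have "{i \<in> {1<..<order (G \<oplus> H)}. degree (G \<oplus> H) i = k} = (?A \<union> ?J) \<union> sh ` ?B" (is "?l = ?r")
  proof (rule set_eqI)
    fix i
    show "i \<in> ?l \<longleftrightarrow> i \<in> ?r"
    proof (cases "a < i")
      case True
      have "i \<in> sh ` ?B \<longleftrightarrow> i - (a - 1) \<in> ?B"
      proof
        assume "i - (a - 1) \<in> ?B"
        moreover have "i = sh (i - (a - 1))" using True by (simp add: sh_def)
        ultimately show "i \<in> sh ` ?B" by blast
      qed (auto simp: sh_def)
      moreover have "i \<notin> ?A \<union> ?J" using True by auto
      moreover have "i \<in> ?l \<longleftrightarrow> i - (a - 1) \<in> ?B"
        using True ab deg[of i] by (auto simp: order_concat simp flip: a_def b_def)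
      ultimately show ?thesis by blast
    next
      case False
      then have "i \<notin> sh ` ?B" using ab by (auto simp: sh_def)
      moreover have "i \<in> ?l \<longleftrightarrow> i \<in> ?A \<union> ?J"
        using False ab deg[of i] by (auto simp: order_concat simp flip: a_def b_def split: if_splits)
      ultimately show ?thesis by blast
    qed
  qed
  moreover have "card ((?A \<union> ?J) \<union> sh ` ?B) = card ?A + card ?J + card (sh ` ?B)"
  proof -
    have "?A \<inter> ?J = {}" "(?A \<union> ?J) \<inter> sh ` ?B = {}" using ab by (auto simp: sh_def)
    then show ?thesis by (simp add: card_Un_disjoint)
  qed
  moreover have "card (sh ` ?B) = card ?B"
    by (rule card_image) (auto simp: inj_on_def sh_def)
  moreover have "card ?J = of_bool (junction_degree G H = k)" by auto
  ultimately show ?thesis by (simp add: interior_count_def a_def b_def)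
qed

lemma degree_fraction_eq:
  assumes "wf_graph G"
  shows "degree_fraction k G =
    (interior_count k G + of_bool (boundary_degree G = k)) / (order G - 1)"
proof -
  have ab: "2 \<le> order G" using assms by (auto simp: wf_graph_def)
  let ?A = "{i \<in> {1<..<order G}. degree G i = k}" and ?J = "{i \<in> {1::nat}. boundary_degree G = k}"
  have "{i \<in> {1..<order G}. merged_degree G i = k} = ?A \<union> ?J"
    using ab by (auto simp: merged_degree_def boundary_degree_def first_degree_def last_degree_def)
  moreover have "card (?A \<union> ?J) = card ?A + card ?J"
    by (rule card_Un_disjoint) auto
  moreover have "card ?J = of_bool (boundary_degree G = k)" by auto
  ultimately show ?thesis
    by (simp add: degree_fraction_def interior_count_def)
qed

section \<open>Orders and boundary degrees along a word\<close>

lemma wf_glo: "wf_graph (glo u)" and wf_ghi: "wf_graph (ghi u)"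
proof (induction u rule: rev_induct)
  case (snoc s u)
  note wf = snoc wf_concat[OF snoc]
  case 1 with wf show ?case by (cases s) (simp_all add: gmid_def)
  case 2 with wf show ?case by (cases s) (simp_all add: gmid_def)
qed (simp_all add: wf_initial_graph)

lemma wf_gmid: "wf_graph (gmid u)"
  unfolding gmid_def by (intro wf_concat wf_glo wf_ghi)

lemma order_glo: "order (glo u) = snd (lo u) + 1" and order_ghi: "order (ghi u) = snd (hi u) + 1"
proof (induction u rule: rev_induct)
  case (snoc s u)
  case 1 with snoc show ?case by (cases s) (simp_all add: gmid_def snd_mid order_concat)
  case 2 with snoc show ?case by (cases s) (simp_all add: gmid_def snd_mid order_concat)
qed (simp_all add: initial_graph_def)

lemma order_gmid: "order (gmid u) = snd (mid u) + 1"
  by (simp add: gmid_def order_concat order_glo order_ghi snd_mid)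

lemma first_degree_gmid: "first_degree (gmid u) = first_degree (glo u) + 1"
  and last_degree_gmid: "last_degree (gmid u) = last_degree (ghi u) + 1"
  by (simp_all add: gmid_def first_degree_concat last_degree_concat wf_glo wf_ghi)

lemma initial_degrees: "first_degree initial_graph = 1" "last_degree initial_graph = 1"
proof -
  have "{e \<in> {{1, 2}}. i \<in> e} = {{1, 2}}" if "i \<in> {1, 2}" for i :: nat using that by auto
  then show "first_degree initial_graph = 1" "last_degree initial_graph = 1"
    by (simp_all add: first_degree_def last_degree_def degree_def initial_graph_def)
qed

lemma boundary_degree_gmid: "boundary_degree (gmid u) = length u + 4"
proof -
  \<comment> \<open>Each letter raises exactly one summand by one: \<open>L\<close> puts
    \<open>gmid u\<close> in place of the upper graph, \<open>R\<close> in place of the lower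
    one.\<close>
  have "first_degree (glo u) + last_degree (ghi u) = length u + 2"
  proof (induction u rule: rev_induct)
    case (snoc s u)
    then show ?case by (cases s) (simp_all add: first_degree_gmid last_degree_gmid)
  qed (simp add: initial_degrees)
  then show ?thesis by (simp add: boundary_degree_def first_degree_gmid last_degree_gmid)
qed

section \<open>Junctions and the interior nodes they create\<close>

definition junction :: "step list \<Rightarrow> nat" where
  "junction u = junction_degree (glo u) (ghi u)"

text \<open>After \<open>L\<close> the upper graph is \<open>gmid u\<close>, which starts with
  \<open>glo u\<close> and has first degree \<open>first_degree (glo u) + 1\<close>; the last degree
  of \<open>glo u\<close> completes the boundary degree. The case \<open>R\<close> is
  symmetric.\<close>

lemma junction_snoc:
  "junction (u @ [L]) = boundary_degree (glo u) + 1"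
  "junction (u @ [R]) = boundary_degree (ghi u) + 1"
  by (simp_all add: junction_def junction_degree_def boundary_degree_def first_degree_gmid last_degree_gmid)

lemma junction_Nil: "junction [] = 2"
  by (simp add: junction_def junction_degree_def initial_degrees)

text \<open>An endpoint other than \<open>0/1\<close> and \<open>1/1\<close> is the node at which the path took its last step away
  from that side.\<close>

lemma boundary_degree_glo_eqD:
  assumes "boundary_degree (glo u) = k + 4"
  shows "k < length u" "u ! k = R" "\<And>i. k < i \<Longrightarrow> i < length u \<Longrightarrow> u ! i = L"
proof -
  have "k < length u \<and> u ! k = R \<and> (\<forall>i. k < i \<longrightarrow> i < length u \<longrightarrow> u ! i = L)"
    using assms
  proof (induction u rule: rev_induct)
    case (snoc s u)
    then show ?case
      by (cases s) (auto simp: boundary_degree_gmid nth_append less_Suc_eq)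
  \<comment> \<open>The graph of 0/1 has boundary degree 2, less than \<open>k + 4\<close>.\<close>
  qed (simp add: boundary_degree_def initial_degrees)
  then show "k < length u" "u ! k = R" "\<And>i. k < i \<Longrightarrow> i < length u \<Longrightarrow> u ! i = L" by auto
qed

lemma boundary_degree_ghi_eqD:
  assumes "boundary_degree (ghi u) = k + 4"
  shows "k < length u" "u ! k = L" "\<And>i. k < i \<Longrightarrow> i < length u \<Longrightarrow> u ! i = R"
proof -
  have "k < length u \<and> u ! k = L \<and> (\<forall>i. k < i \<longrightarrow> i < length u \<longrightarrow> u ! i = R)"
    using assms
  proof (induction u rule: rev_induct)
    case (snoc s u)
    then show ?case
      by (cases s) (auto simp: boundary_degree_gmid nth_append less_Suc_eq)
  qed (simp add: boundary_degree_def initial_degrees)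
  then show "k < length u" "u ! k = L" "\<And>i. k < i \<Longrightarrow> i < length u \<Longrightarrow> u ! i = R" by auto
qed

text \<open>The junction lies next to an end of boundary degree \<open>k + 4\<close>, which is the
  node of the first \<open>k\<close> letters. The path left it by the letter \<open>u ! k\<close>
  and has taken only the opposite letter since, the last step included.\<close>

lemma junction_eqD:
  assumes "junction u = k + 5"
  shows "Suc k < length u" "\<And>i. k < i \<Longrightarrow> i < length u \<Longrightarrow> u ! i \<noteq> u ! k"
proof -
  have "Suc k < length u \<and> (\<forall>i. k < i \<longrightarrow> i < length u \<longrightarrow> u ! i \<noteq> u ! k)"
  proof (cases u rule: rev_cases)
    case (snoc v s)
    show ?thesis
    proof (cases s)
      case L
      then have "boundary_degree (glo v) = k + 4" using assms snoc by (simp add: junction_snoc)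
      note * = boundary_degree_glo_eqD[OF this]
      show ?thesis using * snoc L by (auto simp: nth_append less_Suc_eq)
    next
      case R
      then have "boundary_degree (ghi v) = k + 4" using assms snoc by (simp add: junction_snoc)
      note * = boundary_degree_ghi_eqD[OF this]
      show ?thesis using * snoc R by (auto simp: nth_append less_Suc_eq)
    qed
  qed (use assms in \<open>simp add: junction_Nil\<close>)
  then show "Suc k < length u" "\<And>i. k < i \<Longrightarrow> i < length u \<Longrightarrow> u ! i \<noteq> u ! k" by auto
qed

text \<open>The letter \<open>s\<close> makes \<open>mid v\<close> an end of the interval and
  \<open>s'\<close> steps towards it, so the degree is one more than its boundary degree
  \<open>length v + 4\<close>.\<close>

lemma junction_turn:
  assumes "s \<noteq> s'"
  shows "junction (v @ [s, s']) = length v + 5"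
proof -
  have "junction ((v @ [s]) @ [s']) = length v + 5"
    using assms
    by (cases s; cases s') (simp_all only: junction_snoc glo_ghi_simps boundary_degree_gmid, simp_all)
  then show ?thesis by simp
qed

lemma interior_count_gmid:
  "interior_count k (gmid u) =
    interior_count k (glo u) + interior_count k (ghi u) + of_bool (junction u = k)"
  by (simp add: gmid_def interior_count_concat wf_glo wf_ghi junction_def)

text \<open>Every interior node of \<open>gmid u\<close> is the junction of some prefix of
  \<open>u\<close>.\<close>

lemma interior_count_zero:
  assumes "\<And>v w. u = v @ w \<Longrightarrow> junction v \<noteq> k"
  shows "interior_count k (gmid u) = 0"
proof -
  have "interior_count k (glo u) = 0 \<and> interior_count k (ghi u) = 0"
    using assms
  proof (induction u rule: rev_induct)
    case Nil
    show ?case by (simp add: interior_count_def initial_graph_def)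
  next
    case (snoc s u)
    have IH: "interior_count k (glo u) = 0 \<and> interior_count k (ghi u) = 0"
      by (rule snoc.IH) (use snoc.prems in auto)
    moreover have "junction u \<noteq> k" by (rule snoc.prems) simp
    ultimately show ?case by (cases s) (simp_all add: interior_count_gmid)
  qed
  moreover have "junction u \<noteq> k" by (rule assms) simp
  ultimately show ?thesis by (simp add: interior_count_gmid)
qed

text \<open>Each \<open>gmid w\<close> is a summand of \<open>gmid (w @ [s])\<close>.\<close>

lemma interior_count_gmid_mono: "interior_count k (gmid u) \<le> interior_count k (gmid (u @ v))"
proof (induction v rule: rev_induct)
  case (snoc s v)
  have "interior_count k (gmid w) \<le> interior_count k (gmid (w @ [s]))" for w
    using interior_count_gmid[of k "w @ [s]"] by (cases s) simp_all
  from order_trans[OF snoc this] show ?case by simp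
qed simp

text \<open>As \<open>u\<close> omits the first letter of the path and is indexed from 0,
  \<open>u ! k\<close> is the letter number k + 2. For \<kappa> = k + 5 the two letters are those at
  \<kappa> - 3 and \<kappa> - 2.\<close>

lemma interior_count_eq_zero_iff:
  assumes "Suc k < length u"
  shows "interior_count (k + 5) (gmid u) = 0 \<longleftrightarrow> u ! k = u ! Suc k"
proof
  assume eq: "u ! k = u ! Suc k"
  show "interior_count (k + 5) (gmid u) = 0"
  proof (rule interior_count_zero, rule notI)
    fix v w assume v: "u = v @ w" "junction v = k + 5"
    from junction_eqD(1)[OF v(2)] junction_eqD(2)[OF v(2), of "Suc k"] eq v(1)
    show False by (simp add: nth_append)
  qed
next
  assume zero: "interior_count (k + 5) (gmid u) = 0"
  show "u ! k = u ! Suc k"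
  proof (rule ccontr)
    assume neq: "u ! k \<noteq> u ! Suc k"
    define v where "v = take k u @ [u ! k, u ! Suc k]"
    have "v = take (Suc (Suc k)) u" using assms by (simp add: v_def take_Suc_conv_app_nth)
    then obtain w where "u = v @ w" by (metis append_take_drop_id)
    moreover have "junction v = k + 5" using junction_turn[OF neq, of "take k u"] assms by (simp add: v_def)
    then have "0 < interior_count (k + 5) (gmid v)" by (simp add: interior_count_gmid)
    ultimately show False using zero interior_count_gmid_mono[of "k + 5" v w] by simp
  qed
qed

lemma degree_fraction_gmid:
  "degree_fraction k (gmid u) = (interior_count k (gmid u) + of_bool (length u + 4 = k)) / snd (mid u)"
  by (simp add: degree_fraction_eq[OF wf_gmid] order_gmid boundary_degree_gmid)

section \<open>Irrational paths\<close>

text \<open>A generalized mediant with real weights; avoiding division admits the virtual end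
  1/0.\<close>

definition weighted_mean :: "real \<Rightarrow> real \<Rightarrow> real \<Rightarrow> fraction \<Rightarrow> fraction \<Rightarrow> bool" where
  "weighted_mean \<alpha> \<beta> x f g \<longleftrightarrow> 0 < \<alpha> \<and> 0 < \<beta> \<and>
     x * (\<alpha> * snd f + \<beta> * snd g) = \<alpha> * fst f + \<beta> * fst g"

lemma weighted_mean_step:
  assumes "weighted_mean \<alpha> \<beta> x f g"
  shows "\<beta> < \<alpha> \<Longrightarrow> weighted_mean (\<alpha> - \<beta>) \<beta> x f (mediant f g)"
    "\<alpha> < \<beta> \<Longrightarrow> weighted_mean \<alpha> (\<beta> - \<alpha>) x (mediant f g) g"
  using assms by (auto simp: weighted_mean_def mediant_def algebra_simps)

text \<open>With lower end p/q, upper end p'/q' and D = \<alpha> q + \<beta> q', determinant one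
  gives D (x q - p) = \<beta> and D (p' - x q') = \<alpha>.\<close>

lemma weighted_mean_between:
  assumes "weighted_mean \<alpha> \<beta> x (lo u) (hi u)"
  shows "frac_val (lo u) < x" "x < frac_val (hi u)"
proof -
  define p q p' q' where pq: "p = real (fst (lo u))" "q = real (snd (lo u))"
    "p' = real (fst (hi u))" "q' = real (snd (hi u))"
  have pos: "0 < \<alpha>" "0 < \<beta>" "0 < q" "0 < q'"
    using assms snd_lo_pos snd_hi_pos by (auto simp: weighted_mean_def pq)
  have det: "p' * q - p * q' = 1"
    using arg_cong[OF lo_hi_determinant[of u], of real] by (simp add: pq)
  have mean: "x * (\<alpha> * q + \<beta> * q') = \<alpha> * p + \<beta> * p'"
    using assms by (simp add: weighted_mean_def pq)
  have D: "0 < \<alpha> * q + \<beta> * q'" using pos by (simp add: add_pos_pos)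
  have "(\<alpha> * q + \<beta> * q') * (x * q - p) = (x * (\<alpha> * q + \<beta> * q')) * q - (\<alpha> * q + \<beta> * q') * p"
    by (simp add: algebra_simps)
  also have "\<dots> = \<beta> * (p' * q - p * q')" unfolding mean by (simp add: algebra_simps)
  finally have "0 < (\<alpha> * q + \<beta> * q') * (x * q - p)" using det pos by simp
  then have "0 < x * q - p" using D by (simp add: zero_less_mult_iff)
  then show "frac_val (lo u) < x" using pos by (simp add: frac_val_def pq field_simps)
  have "(\<alpha> * q + \<beta> * q') * (p' - x * q') = (\<alpha> * q + \<beta> * q') * p' - (x * (\<alpha> * q + \<beta> * q')) * q'"
    by (simp add: algebra_simps)
  also have "\<dots> = \<alpha> * (p' * q - p * q')" unfolding mean by (simp add: algebra_simps)
  finally have "0 < (\<alpha> * q + \<beta> * q') * (p' - x * q')" using det pos by simp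
  then have "0 < p' - x * q'" using D by (simp add: zero_less_mult_iff)
  then show "x < frac_val (hi u)" using pos by (simp add: frac_val_def pq field_simps)
qed

text \<open>The width is exactly 1/(q q') by the determinant, and q q' is at least q + q' - 1 for
  positive integers.\<close>

lemma interval_width: "frac_val (hi u) - frac_val (lo u) \<le> 1 / (length u + 1)"
proof -
  let ?q = "snd (lo u)" and ?q' = "snd (hi u)"
  have pos: "0 < ?q" "0 < ?q'" using snd_lo_pos snd_hi_pos by auto
  have "real (fst (hi u)) * ?q = real (fst (lo u)) * ?q' + 1"
    using arg_cong[OF lo_hi_determinant[of u], of real] by simp
  then have "frac_val (hi u) - frac_val (lo u) = 1 / real (?q * ?q')"
    using pos by (simp add: frac_val_def field_simps)
  moreover have "length u + 1 \<le> ?q * ?q'"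
  proof -
    obtain a b where "?q = Suc a" "?q' = Suc b" using pos by (metis Suc_pred)
    then show ?thesis using snd_lo_add_snd_hi_ge[of u] by simp
  qed
  then have "1 / real (?q * ?q') \<le> 1 / real (length u + 1)"
    by (intro divide_left_mono) (use pos in \<open>auto simp del: of_nat_mult simp: zero_less_mult_iff\<close>)
  ultimately show ?thesis by simp
qed

section \<open>Continued fraction blocks of an irrational number\<close>

context
  fixes x :: real
  assumes irrational: "x \<notin> \<rat>" and unit: "0 < x" "x < 1"
begin

lemma cf_remainder_props: "cf_remainder x m \<notin> \<rat>" "0 < cf_remainder x m" "cf_remainder x m < 1"
proof -
  have "cf_remainder x m \<notin> \<rat> \<and> 0 < cf_remainder x m \<and> cf_remainder x m < 1"
  proof (induction m)
    case (Suc m)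
    let ?r = "cf_remainder x m"
    have "1 / ?r \<notin> \<rat>"
      using Suc Rats_inverse[of "1 / ?r"] by (auto simp: inverse_eq_divide)
    then have "frac (1 / ?r) \<notin> \<rat>"
      using Rats_add[of "frac (1 / ?r)" "of_int \<lfloor>1 / ?r\<rfloor>"] by (auto simp: frac_def)
    moreover from this have "frac (1 / ?r) \<noteq> 0" by (metis Rats_0)
    ultimately show ?case
      using frac_ge_0[of "1 / ?r"] frac_lt_1[of "1 / ?r"] by simp
  qed (use irrational unit in auto)
  then show "cf_remainder x m \<notin> \<rat>" "0 < cf_remainder x m" "cf_remainder x m < 1" by auto
qed

lemma cf_quotient_Suc:
  "real (cf_quotient x (Suc m)) = 1 / cf_remainder x m - cf_remainder x (Suc m)"
  "0 < cf_quotient x (Suc m)"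
proof -
  have ge: "1 \<le> 1 / cf_remainder x m" using cf_remainder_props[of m] by (simp add: field_simps)
  then show "0 < cf_quotient x (Suc m)" by (simp add: cf_quotient_def)
  from ge have "1 \<le> \<lfloor>1 / cf_remainder x m\<rfloor>" by (simp add: le_floor_iff)
  then show "real (cf_quotient x (Suc m)) = 1 / cf_remainder x m - cf_remainder x (Suc m)"
    by (simp add: cf_quotient_def frac_def del: one_le_floor)
qed

definition block_end :: "nat \<Rightarrow> nat" where
  "block_end m = (\<Sum>i=1..m. cf_quotient x i)"

lemma block_end_simps [simp]:
  "block_end 0 = 0" "block_end (Suc m) = block_end m + cf_quotient x (Suc m)"
  by (simp_all add: block_end_def)

lemma block_end_mono: "m \<le> n \<Longrightarrow> block_end m \<le> block_end n"
  by (rule lift_Suc_mono_le[of block_end]) auto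

lemma le_block_end: "m \<le> block_end m"
proof (induction m)
  case (Suc m)
  then show ?case using cf_quotient_Suc(2)[of m] by simp
qed simp

text \<open>Here \<open>m\<close> counts the completed blocks, so an even \<open>m\<close> refers to
  the odd-numbered block \<open>m + 1\<close> and its letter \<open>L\<close>.\<close>

lemma irrational_path_block:
  assumes "i < cf_quotient x (Suc m)"
  shows "irrational_path x (Suc (block_end m + i)) = (if even m then L else R)"
proof -
  have "(LEAST n. Suc (block_end m + i) \<le> block_end n) = Suc m"
  proof (rule Least_equality)
    show "Suc (block_end m + i) \<le> block_end (Suc m)" using assms by simp
    fix n assume n: "Suc (block_end m + i) \<le> block_end n"
    show "Suc m \<le> n"
    proof (rule ccontr)
      assume "\<not> Suc m \<le> n"
      then have "block_end n \<le> block_end m" by (intro block_end_mono) simp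
      with n show False by simp
    qed
  qed
  then show ?thesis unfolding irrational_path_def block_end_def[symmetric] by simp
qed

lemma irrational_path_first: "irrational_path x (Suc 0) = L"
  using irrational_path_block[of 0 0] cf_quotient_Suc(2)[of 0] by simp

lemma irrational_path_recurs: "\<exists>k\<ge>n. irrational_path x k = s"
proof -
  \<comment> \<open>The parity of \<open>m\<close> selects the letter, and
    \<open>m \<le> block_end m\<close> makes the block start late enough; it is nonempty since
    quotients are positive.\<close>
  define m where "m = (if s = L then 2 * n else 2 * n + 1)"
  have "irrational_path x (Suc (block_end m)) = s"
    using irrational_path_block[of 0 m] cf_quotient_Suc(2)[of m] by (cases s) (auto simp: m_def)
  moreover have "n \<le> Suc (block_end m)" using le_block_end[of m] by (simp add: m_def split: if_splits)
  ultimately show ?thesis by blast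
qed

text \<open>The weights of \<open>x\<close> in its Farey interval run through the subtractive Euclidean algorithm started
  at \<open>(1, x)\<close>, in the virtual interval from \<open>0/1\<close> to \<open>1/0\<close>; inside the block of the quotient
  \<open>a\<^bsub>m+1\<^esub> = \<lfloor>1/r\<^sub>m\<rfloor>\<close> their ratio decreases from \<open>1/r\<^sub>m\<close> to \<open>r\<^bsub>m+1\<^esub>\<close> in steps of one.\<close>

lemma irrational_path_weights:
  "\<exists>m i \<alpha> \<beta>. k = block_end m + i \<and> i < cf_quotient x (Suc m) \<and>
     case_prod (weighted_mean \<alpha> \<beta> x)
       (descend mediant ((0, 1), (1, 0)) (map (irrational_path x) [1..<Suc k])) \<and>
     (if even m then \<alpha> = \<beta> * (1 / cf_remainder x m - i) else \<beta> = \<alpha> * (1 / cf_remainder x m - i))"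
proof (induction k)
  case 0
  \<comment> \<open>Initially the weights are 1 and x, because x (1 * 1 + x * 0) = 1 * 0 + x * 1,
    and their ratio is 1/x.\<close>
  show ?case
    using unit cf_quotient_Suc(2)[of 0]
    by (intro exI[of _ 0] exI[of _ 1] exI[of _ x]) (simp add: weighted_mean_def)
next
  case (Suc k)
  obtain f g where fg: "descend mediant ((0, 1), (1, 0)) (map (irrational_path x) [1..<Suc k]) = (f, g)"
    by (rule prod.exhaust)
  obtain m i \<alpha> \<beta> where k: "k = block_end m + i" and i: "i < cf_quotient x (Suc m)"
    and w: "weighted_mean \<alpha> \<beta> x f g"
    and ratio: "if even m then \<alpha> = \<beta> * (1 / cf_remainder x m - i) else \<beta> = \<alpha> * (1 / cf_remainder x m - i)"
    using Suc unfolding fg prod.case by (elim exE conjE) (rule that)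
  have pos: "0 < \<alpha>" "0 < \<beta>" using w by (auto simp: weighted_mean_def)
  \<comment> \<open>The ratio after this step. It is positive since 1/r exceeds the quotient of the
    block, which is at least i + 1; hence both weights stay positive.\<close>
  define v where "v = 1 / cf_remainder x m - Suc i"
  have v: "0 < v"
  proof -
    have "real (Suc i) \<le> real (cf_quotient x (Suc m))" using i by (simp only: of_nat_le_iff Suc_le_eq)
    then show ?thesis
      unfolding cf_quotient_Suc(1) v_def using cf_remainder_props(2)[of "Suc m"] by linarith
  qed
  define \<alpha>' \<beta>' where "\<alpha>' = (if even m then \<alpha> - \<beta> else \<alpha>)" and "\<beta>' = (if even m then \<beta> else \<beta> - \<alpha>)"
  have ratio': "if even m then \<alpha>' = \<beta>' * v else \<beta>' = \<alpha>' * v"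
    using ratio by (auto simp: \<alpha>'_def \<beta>'_def v_def algebra_simps)
  have gt: "if even m then \<beta> < \<alpha> else \<alpha> < \<beta>"
  proof (cases "even m")
    case True
    with ratio' have "\<alpha> - \<beta> = \<beta> * v" by (simp add: \<alpha>'_def \<beta>'_def)
    moreover have "0 < \<beta> * v" using pos v by simp
    ultimately show ?thesis using True by simp
  next
    case False
    with ratio' have "\<beta> - \<alpha> = \<alpha> * v" by (simp add: \<alpha>'_def \<beta>'_def)
    moreover have "0 < \<alpha> * v" using pos v by simp
    ultimately show ?thesis using False by simp
  qed
  have "map (irrational_path x) [1..<Suc (Suc k)] =
      map (irrational_path x) [1..<Suc k] @ [if even m then L else R]"
    using irrational_path_block[OF i] by (simp add: k)
  then have w': "case_prod (weighted_mean \<alpha>' \<beta>' x)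
      (descend mediant ((0, 1), (1, 0)) (map (irrational_path x) [1..<Suc (Suc k)]))"
    using weighted_mean_step[OF w] gt
    by (simp only: descend_snoc fg) (auto simp: \<alpha>'_def \<beta>'_def)
  show ?case
  proof (cases "Suc i < cf_quotient x (Suc m)")
    case True
    have "Suc k = block_end m + Suc i" by (simp add: k)
    then show ?thesis
      using True w' ratio' unfolding v_def by (intro exI conjI)
  next
    \<comment> \<open>At the end of a block the ratio equals the next remainder, which is below one.
      The weights swap roles, and the inverse ratio opens the next block.\<close>
    case False
    then have "Suc i = cf_quotient x (Suc m)" using i by simp
    then have "Suc k = block_end (Suc m) + 0" "v = cf_remainder x (Suc m)"
      using cf_quotient_Suc(1)[of m] by (simp_all add: k v_def)
    moreover have "if even (Suc m) then \<alpha>' = \<beta>' * (1 / cf_remainder x (Suc m) - (0::nat))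
        else \<beta>' = \<alpha>' * (1 / cf_remainder x (Suc m) - (0::nat))"
      using ratio' v \<open>v = cf_remainder x (Suc m)\<close>[symmetric] by auto
    ultimately show ?thesis
      using w' cf_quotient_Suc(2)[of "Suc m"] by (intro exI conjI)
  qed
qed

text \<open>The letters after the initial \<open>L\<close>: the path is numbered from 1 and its
  first letter is dropped, hence \<open>i + 2\<close>.\<close>

definition path_tail :: "nat \<Rightarrow> step list" where
  "path_tail n = map (\<lambda>i. irrational_path x (i + 2)) [0..<n]"

lemma length_path_tail [simp]: "length (path_tail n) = n"
  by (simp add: path_tail_def)

lemma path_tail_Suc: "path_tail (Suc n) = path_tail n @ [irrational_path x (n + 2)]"
  by (simp add: path_tail_def)

lemma path_tail_nth: "i < n \<Longrightarrow> path_tail n ! i = irrational_path x (i + 2)"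
  by (simp add: path_tail_def)

lemma path_prefix_eq: "map (irrational_path x) [1..<Suc (Suc n)] = L # path_tail n"
proof -
  have "[1..<Suc (Suc n)] = 1 # map (\<lambda>i. i + 2) [0..<n]"
    unfolding map_add_upt by (subst upt_conv_Cons) (auto simp: numeral_2_eq_2)
  then show ?thesis by (simp add: irrational_path_first path_tail_def)
qed

text \<open>The initial \<open>L\<close> turns the virtual interval from 0/1 to 1/0 into the one
  from 0/1 to 1/1.\<close>

lemma path_tail_weights: "\<exists>\<alpha> \<beta>. weighted_mean \<alpha> \<beta> x (lo (path_tail n)) (hi (path_tail n))"
proof -
  obtain \<alpha> \<beta> where
    "case_prod (weighted_mean \<alpha> \<beta> x) (descend mediant ((0, 1), (1, 0)) (L # path_tail n))"
    using irrational_path_weights[of "Suc n"] unfolding path_prefix_eq by (elim exE conjE) (rule that)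
  then show ?thesis by (auto simp: lo_def hi_def mediant_def split: prod.splits)
qed

lemma path_node_irrational: "path_node x (Suc n) = mid (path_tail n)"
proof -
  have "path_step x = irrational_path x" using irrational by (simp add: path_step_def fun_eq_iff)
  then have "map (path_step x) [1..<Suc n + 1] = L # path_tail n"
    using path_prefix_eq[of n] by simp
  then show ?thesis
    unfolding path_node_def by (intro the_equality) (simp_all add: node_path_iff)
qed

lemma frac_val_mid_path_tail_tendsto: "(\<lambda>n. frac_val (mid (path_tail n))) \<longlonglongrightarrow> x"
proof -
  have "norm (frac_val (mid (path_tail n)) - x) \<le> 1 / real (Suc n)" for n
  proof -
    obtain \<alpha> \<beta> where "weighted_mean \<alpha> \<beta> x (lo (path_tail n)) (hi (path_tail n))"
      using path_tail_weights by blast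
    from weighted_mean_between[OF this] frac_val_lo_mid_hi[of "path_tail n"] interval_width[of "path_tail n"]
    show ?thesis by (simp add: abs_le_iff)
  qed
  then have "(\<lambda>n. frac_val (mid (path_tail n)) - x) \<longlonglongrightarrow> 0"
    by (intro tendsto_norm_zero_cancel[OF tendsto_sandwich[OF _ _ tendsto_const lim_1_over_n[THEN LIMSEQ_Suc]]])
      simp_all
  then show ?thesis by (simp add: LIM_zero_iff)
qed

section \<open>Limits of the degree fractions\<close>

lemma degree_dist_irrational_eq_lim:
  assumes "(\<lambda>n. degree_fraction k (gmid (path_tail n))) \<longlonglongrightarrow> l"
  shows "degree_dist k x = l"
proof -
  have "(\<lambda>j. degree_fraction k (haros_graph (path_node x j))) \<longlonglongrightarrow> l"
    \<comment> \<open>A tail of \<open>n\<close> letters belongs to the node after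
      \<open>n + 1\<close> steps.\<close>
    by (rule LIMSEQ_imp_Suc) (use assms in \<open>simp add: path_node_irrational haros_graph_mid\<close>)
  then show ?thesis using irrational by (simp add: degree_dist_def limI)
qed

text \<open>The letter at index \<open>k\<close> of the tail recurs later, and
  \<open>junction_eqD\<close> then excludes the degree \<open>k + 5\<close> for good.\<close>

lemma junction_eventually_neq: "\<exists>n\<^sub>0. \<forall>n\<ge>n\<^sub>0. junction (path_tail n) \<noteq> k + 5"
proof -
  obtain j where j: "k + 3 \<le> j" "irrational_path x j = irrational_path x (k + 2)"
    using irrational_path_recurs by blast
  define i where "i = j - 2"
  have "i + 2 = j" using j(1) by (simp add: i_def)
  then have i: "k < i" "irrational_path x (i + 2) = irrational_path x (k + 2)" using j by auto
  have "junction (path_tail n) \<noteq> k + 5" if "Suc i \<le> n" for n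
  proof
    assume "junction (path_tail n) = k + 5"
    from junction_eqD(2)[OF this i(1)] that i show False by (simp add: path_tail_nth)
  qed
  then show ?thesis by blast
qed

lemma degree_fraction_tendsto_pos:
  assumes n0: "\<And>n. n \<ge> n\<^sub>0 \<Longrightarrow> junction (path_tail n) \<noteq> k"
    and pos: "0 < interior_count k (gmid (path_tail n\<^sub>0))"
  shows "\<exists>l>0. (\<lambda>n. degree_fraction k (gmid (path_tail n))) \<longlonglongrightarrow> l"
proof -
  define p q p' q' N N' where pq: "p = real (fst (lo (path_tail n\<^sub>0)))" "q = real (snd (lo (path_tail n\<^sub>0)))"
    "p' = real (fst (hi (path_tail n\<^sub>0)))" "q' = real (snd (hi (path_tail n\<^sub>0)))"
    "N = real (interior_count k (glo (path_tail n\<^sub>0)))" "N' = real (interior_count k (ghi (path_tail n\<^sub>0)))"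
  \<comment> \<open>Cramer's rule with determinant one: the linear form takes the values
    \<open>N\<close> and \<open>N'\<close> at the two ends.\<close>
  define A B where "A = N' * q - N * q'" and "B = N * p' - N' * p"
  define lin where "lin f = A * real (fst f) + B * real (snd f)" for f :: fraction
  have det: "p' * q = p * q' + 1"
    using arg_cong[OF lo_hi_determinant[of "path_tail n\<^sub>0"], of real] by (simp add: pq)
  have "A * p + B * q = N * (p' * q - p * q')" "A * p' + B * q' = N' * (p' * q - p * q')"
    by (simp_all add: A_def B_def algebra_simps)
  then have AB: "A * p + B * q = N" "A * p' + B * q' = N'" using det by simp_all
  have lin_mid: "lin (mid u) = lin (lo u) + lin (hi u)" for u
    by (simp add: lin_def fst_mid snd_mid algebra_simps)
  \<comment> \<open>No junction of degree \<open>k\<close> arises from here on, so the counts and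
    the linear form obey the same additive recursion.\<close>
  have ends: "real (interior_count k (glo (path_tail n))) = lin (lo (path_tail n)) \<and>
      real (interior_count k (ghi (path_tail n))) = lin (hi (path_tail n))" if "n\<^sub>0 \<le> n" for n
    using that
  proof (induction n rule: dec_induct)
    case base
    show ?case using AB by (simp add: lin_def pq)
  next
    case (step n)
    then show ?case
      using n0[of n]
      by (cases "irrational_path x (n + 2)") (simp_all add: path_tail_Suc interior_count_gmid lin_mid)
  qed
  have count: "real (interior_count k (gmid (path_tail n))) = lin (mid (path_tail n))" if "n\<^sub>0 \<le> n" for n
    using ends[OF that] n0[OF that] by (simp add: interior_count_gmid lin_mid)
  \<comment> \<open>For \<open>n > k\<close> the boundary degree \<open>n + 4\<close> differs from
    \<open>k\<close>, so the boundary node does not count.\<close>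
  have "degree_fraction k (gmid (path_tail n)) = A * frac_val (mid (path_tail n)) + B"
    if "max n\<^sub>0 (Suc k) \<le> n" for n
    using count[of n] that snd_mid_pos[of "path_tail n"]
    by (simp add: degree_fraction_gmid lin_def frac_val_def field_simps)
  then have ev: "\<forall>\<^sub>F n in sequentially. degree_fraction k (gmid (path_tail n)) = A * frac_val (mid (path_tail n)) + B"
    unfolding eventually_sequentially by blast
  have "(\<lambda>n. A * frac_val (mid (path_tail n)) + B) \<longlonglongrightarrow> A * x + B"
    by (intro tendsto_intros frac_val_mid_path_tail_tendsto)
  then have "(\<lambda>n. degree_fraction k (gmid (path_tail n))) \<longlonglongrightarrow> A * x + B"
    using tendsto_cong[OF ev] by blast
  moreover have "0 < A * x + B"
  proof -
    obtain \<alpha> \<beta> where w: "weighted_mean \<alpha> \<beta> x (lo (path_tail n\<^sub>0)) (hi (path_tail n\<^sub>0))"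
      using path_tail_weights by blast
    then have \<alpha>\<beta>: "0 < \<alpha>" "0 < \<beta>" and mean: "x * (\<alpha> * q + \<beta> * q') = \<alpha> * p + \<beta> * p'"
      by (auto simp: weighted_mean_def pq)
    have "0 < q" "0 < q'" using snd_lo_pos snd_hi_pos by (simp_all add: pq)
    then have D: "0 < \<alpha> * q + \<beta> * q'" using \<alpha>\<beta> by (simp add: add_pos_pos)
    \<comment> \<open>Clearing the denominator exhibits the limit as a combination of
      \<open>N\<close> and \<open>N'\<close> with the positive weights \<alpha> and \<beta>.\<close>
    have "(A * x + B) * (\<alpha> * q + \<beta> * q') = A * (x * (\<alpha> * q + \<beta> * q')) + B * (\<alpha> * q + \<beta> * q')"
      by (simp add: algebra_simps)
    also have "\<dots> = \<alpha> * (A * p + B * q) + \<beta> * (A * p' + B * q')"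
      unfolding mean by (simp add: algebra_simps)
    also have "\<dots> = \<alpha> * N + \<beta> * N'" by (simp only: AB)
    also have "\<dots> > 0"
    proof -
      \<comment> \<open>The junction at \<open>n\<^sub>0\<close> does not have degree
        \<open>k\<close>, so the nodes counted lie inside the graphs of the two ends.\<close>
      have "0 < N \<or> 0 < N'" "0 \<le> N" "0 \<le> N'"
        using pos n0[of n\<^sub>0] by (auto simp: interior_count_gmid pq)
      then show ?thesis using \<alpha>\<beta> by (auto intro: add_pos_nonneg add_nonneg_pos)
    qed
    finally show ?thesis using D by (simp add: zero_less_mult_iff)
  qed
  ultimately show ?thesis by blast
qed

lemma degree_dist_irrational_eq_zero_iff:
  "degree_dist (k + 5) x = 0 \<longleftrightarrow> irrational_path x (Suc (Suc k)) = irrational_path x (Suc (Suc (Suc k)))"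
proof
  assume eq: "irrational_path x (Suc (Suc k)) = irrational_path x (Suc (Suc (Suc k)))"
  have "degree_fraction (k + 5) (gmid (path_tail n)) = 0" if "k + 2 \<le> n" for n
    using that eq interior_count_eq_zero_iff[of k "path_tail n"]
    by (simp add: degree_fraction_gmid path_tail_nth)
  then have "\<forall>\<^sub>F n in sequentially. degree_fraction (k + 5) (gmid (path_tail n)) = 0"
    unfolding eventually_sequentially by blast
  then show "degree_dist (k + 5) x = 0"
    by (intro degree_dist_irrational_eq_lim tendsto_eventually)
next
  assume zero: "degree_dist (k + 5) x = 0"
  show "irrational_path x (Suc (Suc k)) = irrational_path x (Suc (Suc (Suc k)))"
  proof (rule ccontr)
    assume neq: "irrational_path x (Suc (Suc k)) \<noteq> irrational_path x (Suc (Suc (Suc k)))"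
    obtain n where n: "\<And>m. n \<le> m \<Longrightarrow> junction (path_tail m) \<noteq> k + 5"
      using junction_eventually_neq by blast
    \<comment> \<open>Late enough for both letters to be present and for no further junction of
      degree \<open>k + 5\<close> to appear.\<close>
    define n\<^sub>0 where "n\<^sub>0 = max n (k + 2)"
    have "0 < interior_count (k + 5) (gmid (path_tail n\<^sub>0))"
      using neq interior_count_eq_zero_iff[of k "path_tail n\<^sub>0"] by (simp add: path_tail_nth n\<^sub>0_def)
    then obtain l where "0 < l" "(\<lambda>n. degree_fraction (k + 5) (gmid (path_tail n))) \<longlonglongrightarrow> l"
      using degree_fraction_tendsto_pos[of n\<^sub>0 "k + 5"] n by (auto simp: n\<^sub>0_def)
    then show False using zero degree_dist_irrational_eq_lim by fastforce
  qed
qed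

end

theorem theorem2:
  fixes \<kappa> :: nat and x :: real
  assumes "\<kappa> \<ge> 5" and "x \<in> {0..1}" and "path_length x \<ge> enat (\<kappa> - 2)"
  shows "degree_dist \<kappa> x = 0 \<longleftrightarrow> path_step x (\<kappa> - 3) = path_step x (\<kappa> - 2)"
proof -
  obtain k where k: "\<kappa> = k + 5" using assms(1) by (metis add.commute le_Suc_ex)
  have pos: "\<kappa> - 3 = Suc (Suc k)" "\<kappa> - 2 = Suc (Suc (Suc k))" by (simp_all add: k)
  show ?thesis
  proof (cases "x \<in> \<rat>")
    case True
    then have len: "k + 3 \<le> length (rational_path x)"
      using assms(3) by (simp add: path_length_def k)
    \<comment> \<open>Both ends 0 and 1 have the empty path.\<close>
    have "x \<noteq> 0" "x \<noteq> 1" using len by (auto simp: rational_path_one) (simp add: rational_path_def)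
    then obtain u where u: "x = frac_val (mid u)"
      using rational_is_mid[OF True] assms(2) by (metis atLeastAtMost_iff order_le_less)
    have path: "rational_path x = L # u" by (simp add: u rational_path_mid)
    have "degree_dist \<kappa> x = degree_fraction (k + 5) (gmid u)"
      using True by (simp add: degree_dist_def u farey_fraction_mid haros_graph_mid k)
    \<comment> \<open>The boundary node has degree \<open>length u + 4\<close>, and \<open>u\<close>
      has at least \<open>k + 2\<close> letters, so this exceeds \<open>k + 5\<close>.\<close>
    also have "\<dots> = interior_count (k + 5) (gmid u) / snd (mid u)"
      using len path by (simp add: degree_fraction_gmid)
    finally have "degree_dist \<kappa> x = 0 \<longleftrightarrow> interior_count (k + 5) (gmid u) = 0"
      using snd_mid_pos[of u] by simp
    also have "\<dots> \<longleftrightarrow> u ! k = u ! Suc k"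
      using len path by (intro interior_count_eq_zero_iff) simp
    finally show ?thesis using True path by (simp add: path_step_def pos)
  next
    case False
    then have "x \<noteq> 0" "x \<noteq> 1" by auto
    then have "0 < x" "x < 1" using assms(2) by auto
    from degree_dist_irrational_eq_zero_iff[OF False this, of k] show ?thesis
      using False unfolding pos by (simp add: path_step_def k)
  qed
qed

end
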